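(* Let $\mathbb K$ be an algebraically closed field of characteristic zero and let $L$ be a Lie subalgebra of $W_2(\mathbb K)=\mathrm{Der}_{\mathbb K}(\mathbb K[x,y])$ (not assumed finite dimensional over $\mathbb K$). If $L$ consists of locally nilpotent derivations of the ring $\mathbb K[x,y]$, then there exists an automorphism $\varphi:\mathbb K[x,y]\to\mathbb K[x,y]$ such that $L_1=\varphi L\varphi^{-1}$ is a subalgebra of the triangular Lie algebra $u_2(\mathbb K)$.
   Context: $\mathbb K[x,y]$ is the polynomial ring in two variables; automorphisms are $\mathbb K$-algebra automorphisms. $W_2(\mathbb K)$ is the Lie algebra over $\mathbb K$ of all $\mathbb K$-derivations of $\mathbb K[x,y]$ with bracket $[D_1,D_2]=D_1D_2-D_2D_1$; subalgebra means $\mathbb K$-Lie subalgebra. A derivation $D$ is locally nilpotent if for every $a\in\mathbb K[x,y]$ there is a positive integer $n$ with $D^n(a)=0$. For an automorphism $\varphi$, $\varphi L\varphi^{-1}=\{\varphi\circ D\circ\varphi^{-1} : D\in L\}$. The triangular Lie algebra $u_2(\mathbb K)$ is the subalgebra of $W_2(\mathbb K)$ consisting of all derivations of the form $\alpha\frac{\partial}{\partial x}+\beta(x)\frac{\partial}{\partial y}$ with $\alpha\in\mathbb K$ and $\beta(x)\in\mathbb K[x]$. *)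

theory Defs
  imports "HOL-Computational_Algebra.Polynomial"
begin

text \<open>
  The polynomial ring $K[x,y]$ is represented as $K[x][y]$, i.e. by the type \<open>'a poly poly\<close>:
  the inner indeterminate \<open>[:[:0, 1:]:]\<close> is $x$, the outer one \<open>[:0, 1:]\<close> is $y$,
  and a scalar $c \in K$ is embedded as \<open>[:[:c:]:]\<close>.
\<close>

definition scale2 :: "'a::field \<Rightarrow> 'a poly poly \<Rightarrow> 'a poly poly" where
  "scale2 c p = smult [:c:] p"

definition partial_x :: "'a::field poly poly \<Rightarrow> 'a poly poly" where
  "partial_x p = map_poly pderiv p"

definition partial_y :: "'a::field poly poly \<Rightarrow> 'a poly poly" where
  "partial_y p = pderiv p"

definition W2 :: "('a::field poly poly \<Rightarrow> 'a poly poly) set" where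
  "W2 = {D. (\<forall>p q. D (p + q) = D p + D q)
          \<and> (\<forall>c p. D (scale2 c p) = scale2 c (D p))
          \<and> (\<forall>p q. D (p * q) = D p * q + p * D q)}"

definition lie_bracket ::
  "('a::field poly poly \<Rightarrow> 'a poly poly) \<Rightarrow> ('a poly poly \<Rightarrow> 'a poly poly)
     \<Rightarrow> ('a poly poly \<Rightarrow> 'a poly poly)" where
  "lie_bracket D E = (\<lambda>p. D (E p) - E (D p))"

definition lie_subalgebra ::
  "('a::field poly poly \<Rightarrow> 'a poly poly) set \<Rightarrow> ('a poly poly \<Rightarrow> 'a poly poly) set \<Rightarrow> bool" where
  "lie_subalgebra L A \<longleftrightarrow>
     L \<subseteq> A
   \<and> (\<lambda>p. 0) \<in> L
   \<and> (\<forall>D\<in>L. \<forall>E\<in>L. (\<lambda>p. D p + E p) \<in> L)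
   \<and> (\<forall>c. \<forall>D\<in>L. (\<lambda>p. scale2 c (D p)) \<in> L)
   \<and> (\<forall>D\<in>L. \<forall>E\<in>L. lie_bracket D E \<in> L)"

definition locally_nilpotent :: "('a::field poly poly \<Rightarrow> 'a poly poly) \<Rightarrow> bool" where
  "locally_nilpotent D \<longleftrightarrow> (\<forall>a. \<exists>n>0. (D ^^ n) a = 0)"

definition algebra_automorphism :: "('a::field poly poly \<Rightarrow> 'a poly poly) \<Rightarrow> bool" where
  "algebra_automorphism \<phi> \<longleftrightarrow>
     bij \<phi>
   \<and> \<phi> 1 = 1
   \<and> (\<forall>p q. \<phi> (p + q) = \<phi> p + \<phi> q)
   \<and> (\<forall>p q. \<phi> (p * q) = \<phi> p * \<phi> q)
   \<and> (\<forall>c p. \<phi> (scale2 c p) = scale2 c (\<phi> p))"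

definition conjugate ::
  "('a::field poly poly \<Rightarrow> 'a poly poly) \<Rightarrow> ('a poly poly \<Rightarrow> 'a poly poly) set
     \<Rightarrow> ('a poly poly \<Rightarrow> 'a poly poly) set" where
  "conjugate \<phi> L = (\<lambda>D. \<phi> \<circ> D \<circ> inv \<phi>) ` L"

text \<open>A polynomial \<open>\<beta>\<close> in $x$ alone is the element \<open>[:\<beta>:]\<close> of $K[x][y]$.\<close>

definition u2 :: "('a::field poly poly \<Rightarrow> 'a poly poly) set" where
  "u2 = {D. \<exists>(\<alpha>::'a) (\<beta>::'a poly).
            D = (\<lambda>p. scale2 \<alpha> (partial_x p) + [:\<beta>:] * partial_y p)}"

lemma coeff_partial_x: "coeff (partial_x p) n = pderiv (coeff p n)"
  by (simp add: partial_x_def coeff_map_poly)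

lemma pderiv_sum_fun: "pderiv (sum f A) = (\<Sum>i\<in>A. pderiv (f i))"
  by (induction A rule: infinite_finite_induct) (simp_all add: pderiv_add)

lemma partial_x_add: "partial_x (p + q) = partial_x p + partial_x q"
  by (rule poly_eqI) (simp add: coeff_partial_x pderiv_add)

lemma partial_x_scale2: "partial_x (scale2 c p) = scale2 c (partial_x p)"
  by (rule poly_eqI) (simp add: coeff_partial_x scale2_def pderiv_smult)

lemma partial_x_mult: "partial_x (p * q) = partial_x p * q + p * partial_x q"
  by (rule poly_eqI)
     (simp add: coeff_partial_x coeff_mult pderiv_sum_fun pderiv_mult
        mult.commute[of _ "pderiv (coeff p _)"] sum.distrib add.commute)

lemma partial_x_in_W2: "partial_x \<in> W2"
  by (simp add: W2_def partial_x_add partial_x_scale2 partial_x_mult)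

lemma partial_y_in_W2: "partial_y \<in> W2"
  by (simp add: W2_def partial_y_def scale2_def pderiv_add pderiv_smult pderiv_mult algebra_simps)

lemma partial_x_partial_y: "partial_x (partial_y p) = partial_y (partial_x p)"
proof (rule poly_eqI)
  fix n
  have "pderiv (of_nat (Suc n) * coeff p (Suc n)) = of_nat (Suc n) * pderiv (coeff p (Suc n))"
    by (simp add: pderiv_mult pderiv_add)
  then show "coeff (partial_x (partial_y p)) n = coeff (partial_y (partial_x p)) n"
    by (simp only: partial_y_def coeff_partial_x coeff_pderiv)
qed

lemma u2_subset_W2: "u2 \<subseteq> W2"
proof
  fix D :: "'b::field poly poly \<Rightarrow> 'b poly poly"
  assume "D \<in> u2"
  then obtain a b where D: "D p = scale2 a (partial_x p) + [:b:] * partial_y p" for p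
    unfolding u2_def by auto
  have "scale2 a (partial_x (scale2 c p)) = scale2 c (scale2 a (partial_x p))" for c p
    by (simp add: partial_x_scale2) (simp add: scale2_def mult.commute)
  then show "D \<in> W2"
    by (simp add: W2_def D partial_x_add partial_x_mult)
       (simp add: partial_y_def scale2_def pderiv_add pderiv_smult pderiv_mult
         smult_add_right algebra_simps)
qed

lemma lie_subalgebra_u2:
  "lie_subalgebra (u2 :: ('a::field poly poly \<Rightarrow> 'a poly poly) set) W2"
proof -
  let ?d = "\<lambda>(\<alpha>::'a) \<beta> p. scale2 \<alpha> (partial_x p) + [:\<beta>:] * partial_y p"
  have mem: "?d \<alpha> \<beta> \<in> u2" for \<alpha> \<beta> unfolding u2_def by blast
  have zero: "(\<lambda>p::'a poly poly. 0) = ?d 0 0"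
    by (simp add: scale2_def)
  have add: "(\<lambda>p. ?d a b p + ?d c d p) = ?d (a + c) (b + d)" for a b c d
  proof -
    have "[:a + c:] = [:a:] + [:c:]" by simp
    then show ?thesis
      by (simp only: scale2_def smult_add_left) (simp add: fun_eq_iff smult_add_left algebra_simps)
  qed
  have scl: "(\<lambda>p. scale2 k (?d a b p)) = ?d (k * a) (smult k b)" for k a b
    by (simp add: scale2_def fun_eq_iff smult_add_right mult.commute)
  have px: "partial_x (smult b p) = smult (pderiv b) p + smult b (partial_x p)"
    for b :: "'a poly" and p
    by (rule poly_eqI) (simp add: coeff_partial_x pderiv_mult algebra_simps)
  have py: "partial_y (smult b p) = smult b (partial_y p)" "partial_y (p + q) = partial_y p + partial_y q"
    for b :: "'a poly" and p q
    by (simp_all add: partial_y_def pderiv_smult pderiv_add)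
  have br: "lie_bracket (?d a b) (?d c d) = ?d 0 (smult a (pderiv d) - smult c (pderiv b))"
    for a b c d
    by (rule ext)
       (simp add: lie_bracket_def scale2_def partial_x_add px py partial_x_partial_y
         smult_add_right smult_diff_left pderiv_pCons algebra_simps)
  show ?thesis
    unfolding lie_subalgebra_def
  proof (intro conjI ballI allI)
    show "u2 \<subseteq> W2" by (rule u2_subset_W2)
    show "(\<lambda>p::'a poly poly. 0) \<in> u2" by (subst zero) (rule mem)
  next
    fix D E :: "'a poly poly \<Rightarrow> 'a poly poly" assume "D \<in> u2" "E \<in> u2"
    then obtain a b c d where DE: "D = ?d a b" "E = ?d c d" unfolding u2_def by blast
    show "(\<lambda>p. D p + E p) \<in> u2" unfolding DE add by (rule mem)
    show "lie_bracket D E \<in> u2" unfolding DE br by (rule mem)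
  next
    fix k :: 'a and D :: "'a poly poly \<Rightarrow> 'a poly poly"
    assume "D \<in> u2"
    then obtain a b where D: "D = ?d a b" unfolding u2_def by blast
    show "(\<lambda>p. scale2 k (D p)) \<in> u2" unfolding D scl by (rule mem)
  qed
qed

end

theory Submission
  imports Defs
begin

text \<open>
  Rentschler's theorem brings a single locally nilpotent derivation \<open>D\<close> to the form \<open>f(x) \<partial>/\<partial>y\<close>.
  Let \<open>n\<close>, \<open>m\<close> be the nilpotency degrees of \<open>x\<close>, \<open>y\<close> (the degrees in the time variable of the flow of
  \<open>D\<close>), say \<open>1 \<le> n \<le> m\<close>, and give \<open>x\<close>, \<open>y\<close> the weights \<open>n\<close>, \<open>m\<close>. Either \<open>D\<close> lowers weights, and then it is
  already triangular, or its top homogeneous part \<open>T\<close> is a locally nilpotent derivation whose values vanish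
  at the leading coefficients of the flows of \<open>x\<close> and \<open>y\<close>. Over an algebraically closed field this forces a
  binomial \<open>u = x^t - c y^s\<close> with \<open>u dvd T u\<close>, hence \<open>T u = 0\<close>, hence \<open>s = 1\<close>, and replacing \<open>y\<close> by
  \<open>y - x^t / c\<close> lowers \<open>m\<close>.

  If a Lie algebra \<open>L\<close> of locally nilpotent derivations contains \<open>f(x) \<partial>/\<partial>y\<close> with \<open>f\<close> nonconstant, brackets
  with it show that \<open>L\<close> is triangular. Otherwise one may assume that \<open>\<partial>/\<partial>y\<close>, and if \<open>L\<close> has rank two also
  \<open>\<partial>/\<partial>x\<close>, lies in \<open>L\<close>. An element with nonconstant coefficients could then be modified to vanish at the
  origin, which brings back the first case.
\<close>

subsection \<open>Coefficients of bivariate polynomials\<close>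

definition const2 :: "'a::field \<Rightarrow> 'a poly poly" where
  "const2 c = [:[:c:]:]"

definition var_x :: "'a::field poly poly" where
  "var_x = [:[:0, 1:]:]"

definition var_y :: "'a::field poly poly" where
  "var_y = [:0, 1:]"

text \<open>The arguments \<open>i\<close> and \<open>j\<close> are the exponents of x and y, in the
  reverse of the nesting order of K[x][y].\<close>

definition cf :: "'a::field poly poly \<Rightarrow> nat \<Rightarrow> nat \<Rightarrow> 'a" where
  "cf p i j = coeff (coeff p j) i"

lemma cf_eqI: "(\<And>i j. cf p i j = cf q i j) \<Longrightarrow> p = q"
  by (simp add: cf_def poly_eq_iff)

lemma cf_0 [simp]: "cf 0 i j = 0"
  by (simp add: cf_def)

lemma cf_add [simp]: "cf (p + q) i j = cf p i j + cf q i j"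
  by (simp add: cf_def)

lemma cf_diff: "cf (p - q) i j = cf p i j - cf q i j"
  by (simp add: cf_def)

lemma cf_sum: "cf (sum f A) i j = (\<Sum>a\<in>A. cf (f a) i j)"
  by (simp add: cf_def coeff_sum)

lemma cf_mult:
  "cf (p * q) i j = (\<Sum>k\<le>j. \<Sum>l\<le>i. cf p l k * cf q (i - l) (j - k))"
  by (simp add: cf_def coeff_mult coeff_sum)

lemma cf_const2_mult [simp]: "cf (const2 c * p) i j = c * cf p i j"
  by (simp add: cf_def const2_def)

lemma cf_partial_x: "cf (partial_x p) i j = of_nat (Suc i) * cf p (Suc i) j"
  by (simp add: cf_def coeff_partial_x coeff_pderiv)

lemma cf_partial_y: "cf (partial_y p) i j = of_nat (Suc j) * cf p i (Suc j)"
proof -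
  have "coeff (of_nat k * (r :: 'a poly)) i = of_nat k * coeff r i" for k r
    by (induction k) (simp_all add: algebra_simps)
  then show ?thesis
    by (simp add: cf_def partial_y_def coeff_pderiv del: of_nat_Suc)
qed

lemma var_power_conv_monom: "var_x ^ a * var_y ^ b = monom (monom 1 a) b"
proof -
  have "var_x ^ a = [:monom (1::'a) a:]"
    by (induction a) (simp_all add: var_x_def one_pCons monom_Suc)
  moreover have "var_y ^ b = (monom 1 b :: 'a poly poly)"
    by (induction b) (simp_all add: var_y_def monom_Suc monom_0 flip: one_pCons)
  ultimately show ?thesis
    by (simp add: smult_monom)
qed

lemma cf_monomial:
  "cf (var_x ^ a * var_y ^ b) i j = (if i = a \<and> j = b then 1 else 0)"
  by (auto simp: var_power_conv_monom cf_def)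

lemma cf_var_x: "cf var_x i j = (if i = 1 \<and> j = 0 then 1 else 0)"
  using cf_monomial[of 1 0 i j] by simp

lemma cf_var_y: "cf var_y i j = (if i = 0 \<and> j = 1 then 1 else 0)"
  using cf_monomial[of 0 1 i j] by simp

lemma var_nonzero [simp]: "var_x \<noteq> 0" "var_y \<noteq> 0"
  by (simp_all add: var_x_def var_y_def)

lemma scale2_conv_const2: "scale2 c p = const2 c * p"
  by (simp add: scale2_def const2_def)

lemma const2_simps [simp]:
  "const2 0 = 0" "const2 1 = 1"
  "const2 c = 0 \<longleftrightarrow> c = 0"
  "const2 c = const2 d \<longleftrightarrow> c = d"
  by (simp_all add: const2_def one_pCons)

lemma const2_add: "const2 (c + d) = const2 c + const2 d"
  and const2_mult: "const2 (c * d) = const2 c * const2 d"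
  and const2_diff: "const2 (c - d) = const2 c - const2 d"
  by (simp_all add: const2_def)

lemma const2_of_nat: "const2 (of_nat k) = of_nat k"
  by (induction k) (simp_all add: const2_add)

text \<open>\<open>S\<close> may be larger than the support; this allows sums over all exponents of
  a fixed weight.\<close>

lemma monomial_expansion:
  assumes "\<And>i j. cf p i j \<noteq> 0 \<Longrightarrow> (i, j) \<in> S" "finite S"
  shows "p = (\<Sum>(i, j)\<in>S. const2 (cf p i j) * (var_x ^ i * var_y ^ j))"
proof (rule cf_eqI)
  fix k l
  have "(\<Sum>s\<in>S. cf (case s of (i, j) \<Rightarrow> const2 (cf p i j) * (var_x ^ i * var_y ^ j)) k l)
      = (\<Sum>s\<in>S. if s = (k, l) then cf p k l else 0)"
    by (intro sum.cong) (auto simp: cf_monomial split: if_splits)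
  also have "\<dots> = cf p k l"
    using assms by (auto simp: sum.delta)
  finally show "cf p k l = cf (\<Sum>(i, j)\<in>S. const2 (cf p i j) * (var_x ^ i * var_y ^ j)) k l"
    by (simp add: cf_sum)
qed

lemma finite_support: "finite {(i, j). cf p i j \<noteq> 0}"
proof (rule finite_subset)
  show "{(i, j). cf p i j \<noteq> 0} \<subseteq> (\<Union>j\<in>{..degree p}. {..degree (coeff p j)} \<times> {j})"
  proof clarsimp
    fix i j assume "cf p i j \<noteq> 0"
    then have "coeff p j \<noteq> 0" "coeff (coeff p j) i \<noteq> 0"
      by (auto simp: cf_def)
    then show "j \<le> degree p \<and> i \<le> degree (coeff p j)"
      by (simp add: le_degree)
  qed
qed auto

lemma poly2_induct [case_names monomial add]:
  assumes mono: "\<And>c i j. P (const2 c * (var_x ^ i * var_y ^ j))"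
    and add: "\<And>p q. P p \<Longrightarrow> P q \<Longrightarrow> P (p + q)"
  shows "P p"
proof -
  have P0: "P 0"
    using mono[of 0] by simp
  have "P (\<Sum>(i, j)\<in>S. const2 (cf p i j) * (var_x ^ i * var_y ^ j))" if "finite S" for S
    using that
  proof (induction S)
    case (insert s S)
    then show ?case
      by (cases s) (simp add: mono add)
  qed (simp add: P0)
  note sum = this[OF finite_support[of p]]
  show ?thesis
    by (rule ssubst[where P = P, OF monomial_expansion sum]) (auto simp: finite_support)
qed

subsection \<open>Derivations\<close>

lemma W2_add: "D \<in> W2 \<Longrightarrow> D (p + q) = D p + D q"
  and W2_const2_mult: "D \<in> W2 \<Longrightarrow> D (const2 c * p) = const2 c * D p"
  and W2_mult: "D \<in> W2 \<Longrightarrow> D (p * q) = D p * q + p * D q"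
  unfolding W2_def scale2_conv_const2 by blast+

lemma W2I:
  assumes "\<And>p q. D (p + q) = D p + D q" "\<And>c p. D (const2 c * p) = const2 c * D p"
    "\<And>p q. D (p * q) = D p * q + p * D q"
  shows "D \<in> W2"
  using assms by (simp add: W2_def scale2_conv_const2)

lemma W2_0: "D \<in> W2 \<Longrightarrow> D 0 = 0"
  using W2_const2_mult[of D 0 0] by simp

lemma W2_1: "D \<in> W2 \<Longrightarrow> D 1 = 0"
  by (metis W2_mult add_cancel_right_right mult_1_left mult_1_right)

lemma W2_minus: "D \<in> W2 \<Longrightarrow> D (- p) = - D p"
  using W2_add[of D p "- p"] by (simp add: W2_0 eq_neg_iff_add_eq_0 add.commute)

lemma W2_diff: "D \<in> W2 \<Longrightarrow> D (p - q) = D p - D q"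
  using W2_add[of D p "- q"] by (simp add: W2_minus)

lemma W2_sum: "D \<in> W2 \<Longrightarrow> D (sum f A) = (\<Sum>a\<in>A. D (f a))"
  by (induction A rule: infinite_finite_induct) (simp_all add: W2_0 W2_add)

lemma W2_const2: "D \<in> W2 \<Longrightarrow> D (const2 c) = 0"
  using W2_const2_mult[of D c 1] by (simp add: W2_1)

lemma W2_power_Suc: "D \<in> W2 \<Longrightarrow> D (p ^ Suc k) = of_nat (Suc k) * p ^ k * D p"
  by (induction k) (simp_all add: W2_mult algebra_simps)

lemma W2_power: "D \<in> W2 \<Longrightarrow> D (p ^ k) = of_nat k * p ^ (k - 1) * D p"
  by (cases k) (simp_all add: W2_1 W2_power_Suc del: power_Suc of_nat_Suc)

lemma W2_funpow_0: "D \<in> W2 \<Longrightarrow> (D ^^ k) 0 = 0"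
  by (induction k) (simp_all add: W2_0)

lemma W2_funpow_add: "D \<in> W2 \<Longrightarrow> (D ^^ k) (p + q) = (D ^^ k) p + (D ^^ k) q"
  by (induction k) (simp_all add: W2_add)

lemma W2_funpow_const2_mult: "D \<in> W2 \<Longrightarrow> (D ^^ k) (const2 c * p) = const2 c * (D ^^ k) p"
  by (induction k) (simp_all add: W2_const2_mult)

lemma partial_x_var [simp]: "partial_x var_x = 1" "partial_x var_y = 0"
  by (simp_all add: partial_x_def var_x_def var_y_def map_poly_pCons pderiv_pCons one_pCons)

lemma partial_y_var [simp]: "partial_y var_x = 0" "partial_y var_y = 1"
  by (simp_all add: partial_y_def var_x_def var_y_def pderiv_pCons)

lemma W2_eqI:
  assumes "D \<in> W2" "E \<in> W2" "D var_x = E var_x" "D var_y = E var_y"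
  shows "D = E"
proof
  fix p
  show "D p = E p"
  proof (induction p rule: poly2_induct)
    case (monomial c i j)
    then show ?case
      using assms by (simp add: W2_const2_mult W2_mult W2_power)
  qed (use assms in \<open>simp add: W2_add\<close>)
qed

definition der :: "'a::field poly poly \<Rightarrow> 'a poly poly \<Rightarrow> 'a poly poly \<Rightarrow> 'a poly poly" where
  "der a b p = a * partial_x p + b * partial_y p"

lemma der_in_W2: "der a b \<in> W2"
proof (rule W2I)
  note simps = partial_x_in_W2 partial_y_in_W2 der_def algebra_simps
  show "der a b (p + q) = der a b p + der a b q" for p q
    by (simp add: W2_add simps)
  show "der a b (const2 c * p) = const2 c * der a b p" for c p
    by (simp add: der_def W2_const2_mult partial_x_in_W2 partial_y_in_W2 distrib_left mult.left_commute)
  show "der a b (p * q) = der a b p * q + p * der a b q" for p q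
    by (simp add: W2_mult simps)
qed

lemma der_var [simp]: "der a b var_x = a" "der a b var_y = b"
  by (simp_all add: der_def)

lemma W2_conv_der: "D \<in> W2 \<Longrightarrow> D = der (D var_x) (D var_y)"
  by (rule W2_eqI) (simp_all add: der_in_W2)

lemma W2_apply: "D \<in> W2 \<Longrightarrow> D p = D var_x * partial_x p + D var_y * partial_y p"
  using fun_cong[OF W2_conv_der, of D p] by (simp only: der_def)

lemma W2_apply_poly_x: "D \<in> W2 \<Longrightarrow> D [:q:] = smult (pderiv q) (D var_x)"
  by (simp add: W2_apply[of D "[:q:]"] partial_x_def partial_y_def map_poly_pCons pderiv_pCons)

lemma u2_iff: "D \<in> u2 \<longleftrightarrow> D \<in> W2 \<and> (\<exists>\<alpha> \<beta>. D var_x = const2 \<alpha> \<and> D var_y = [:\<beta>:])"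
proof -
  have "(\<lambda>p. scale2 \<alpha> (partial_x p) + [:\<beta>:] * partial_y p) = der (const2 \<alpha>) [:\<beta>:]" for \<alpha> :: 'a and \<beta>
    by (simp add: fun_eq_iff der_def scale2_conv_const2)
  then have "D \<in> u2 \<longleftrightarrow> (\<exists>\<alpha> \<beta>. D = der (const2 \<alpha>) [:\<beta>:])"
    by (simp add: u2_def)
  also have "\<dots> \<longleftrightarrow> D \<in> W2 \<and> (\<exists>\<alpha> \<beta>. D var_x = const2 \<alpha> \<and> D var_y = [:\<beta>:])"
  proof
    assume "D \<in> W2 \<and> (\<exists>\<alpha> \<beta>. D var_x = const2 \<alpha> \<and> D var_y = [:\<beta>:])"
    then obtain \<alpha> \<beta> where "D \<in> W2" "D var_x = const2 \<alpha>" "D var_y = [:\<beta>:]"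
      by blast
    then have "D = der (const2 \<alpha>) [:\<beta>:]"
      by (intro W2_eqI) (simp_all add: der_in_W2)
    then show "\<exists>\<alpha> \<beta>. D = der (const2 \<alpha>) [:\<beta>:]"
      by blast
  qed (auto simp: der_in_W2)
  finally show ?thesis .
qed

subsection \<open>The flow of a locally nilpotent derivation\<close>

text \<open>The flow exp(t D) p as a polynomial in the time variable t, which is the outermost
  indeterminate. Local nilpotence makes almost all coefficients vanish, as \<open>Abs_poly\<close>
  requires.\<close>

definition flow :: "('a::field_char_0 poly poly \<Rightarrow> 'a poly poly) \<Rightarrow> 'a poly poly \<Rightarrow> 'a poly poly poly"
  where "flow D p = Abs_poly (\<lambda>k. const2 (1 / fact k) * (D ^^ k) p)"

locale lnd =
  fixes D :: "'a::field_char_0 poly poly \<Rightarrow> 'a poly poly"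
  assumes W2: "D \<in> W2" and locally_nilpotent: "locally_nilpotent D"
begin

lemma coeff_flow: "coeff (flow D p) k = const2 (1 / fact k) * (D ^^ k) p"
proof -
  obtain n where n: "(D ^^ n) p = 0"
    using locally_nilpotent unfolding locally_nilpotent_def by blast
  have "const2 (1 / fact i) * (D ^^ i) p = 0" if "i > n" for i
  proof -
    have "(D ^^ i) p = (D ^^ (i - n)) ((D ^^ n) p)"
      using that funpow_add[of "i - n" n D] by simp
    then show ?thesis
      by (simp add: n W2_funpow_0 W2)
  qed
  then show ?thesis
    unfolding flow_def by (subst coeff_Abs_poly[of n]) simp_all
qed

lemma coeff_flow_0 [simp]: "coeff (flow D p) 0 = p"
  by (simp add: coeff_flow)

lemma pderiv_flow: "pderiv (flow D p) = flow D (D p)"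
proof (rule poly_eqI)
  fix k
  have "of_nat (Suc k) * const2 (1 / fact (Suc k)) = const2 (of_nat (Suc k) * (1 / fact (Suc k)) :: 'a)"
    by (simp only: const2_mult const2_of_nat)
  also have "of_nat (Suc k) * (1 / fact (Suc k)) = (1 / fact k :: 'a)"
    by (simp add: field_simps del: of_nat_Suc)
  finally show "coeff (pderiv (flow D p)) k = coeff (flow D (D p)) k"
    by (simp add: coeff_pderiv coeff_flow funpow_swap1 del: of_nat_Suc flip: mult.assoc)
qed

lemma coeff_flow_D: "coeff (flow D (D p)) k = D (coeff (flow D p) k)"
  by (simp add: coeff_flow W2_const2_mult W2 funpow_swap1)

lemma flow_add: "flow D (p + q) = flow D p + flow D q"
  by (rule poly_eqI) (simp add: coeff_flow W2_funpow_add W2 distrib_left)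

lemma flow_const2_mult: "flow D (const2 c * p) = smult (const2 c) (flow D p)"
  by (rule poly_eqI) (simp add: coeff_flow W2_funpow_const2_mult W2 mult.left_commute)

lemma flow_0 [simp]: "flow D 0 = 0"
  using flow_const2_mult[of 0 0] by simp

lemma flow_1 [simp]: "flow D 1 = 1"
proof -
  have "pderiv (flow D 1) = 0"
    by (simp add: pderiv_flow W2_1 W2)
  then obtain c where "flow D 1 = [:c:]"
    using pderiv_eq_0_iff degree_eq_zeroE by blast
  then show ?thesis
    using coeff_flow_0[of 1] by (simp add: one_pCons)
qed

lemma flow_sum: "flow D (sum f A) = (\<Sum>a\<in>A. flow D (f a))"
  by (induction A rule: infinite_finite_induct) (simp_all add: flow_add)

text \<open>Both sides solve the differential equation \<open>F' = D F\<close> with initial value \<open>p * q\<close>.\<close>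

lemma flow_mult: "flow D (p * q) = flow D p * flow D q"
proof (rule poly_eqI)
  fix k
  show "coeff (flow D (p * q)) k = coeff (flow D p * flow D q) k"
  proof (induction k)
    case 0
    then show ?case by (simp add: coeff_mult_0)
  next
    case (Suc k)
    have "of_nat (Suc k) * coeff (flow D p * flow D q) (Suc k)
        = coeff (pderiv (flow D p * flow D q)) k"
      by (simp only: coeff_pderiv)
    also have "\<dots> = coeff (flow D p * flow D (D q) + flow D (D p) * flow D q) k"
      by (simp add: pderiv_mult pderiv_flow mult.commute)
    also have "\<dots> = D (coeff (flow D p * flow D q) k)"
      by (simp add: coeff_mult coeff_flow_D W2_sum W2_mult W2 sum.distrib add.commute)
    also have "\<dots> = coeff (pderiv (flow D (p * q))) k"
      by (simp only: Suc[symmetric] pderiv_flow coeff_flow_D)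
    finally show ?case
      by (simp add: coeff_pderiv del: of_nat_Suc)
  qed
qed

lemma flow_power: "flow D (p ^ k) = flow D p ^ k"
  by (induction k) (simp_all add: flow_mult)

section \<open>The degree in the time variable\<close>

lemma flow_eq_0_iff [simp]: "flow D p = 0 \<longleftrightarrow> p = 0"
  by (metis coeff_0 coeff_flow_0 flow_0)

lemma degree_flow_D: "degree (flow D (D p)) = degree (flow D p) - 1"
  by (simp flip: pderiv_flow add: degree_pderiv)

lemma degree_flow_eq_0_iff: "degree (flow D p) = 0 \<longleftrightarrow> D p = 0"
  using pderiv_eq_0_iff[of "flow D p"] by (simp add: pderiv_flow)

lemma degree_flow_mult:
  "p \<noteq> 0 \<Longrightarrow> q \<noteq> 0 \<Longrightarrow> degree (flow D (p * q)) = degree (flow D p) + degree (flow D q)"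
  by (simp add: flow_mult degree_mult_eq)

text \<open>The flow degree is additive on nonzero products, so a nonzero multiple of
  \<open>p\<close> has at least the flow degree of \<open>p\<close>; but \<open>D\<close> lowers
  that degree by one.\<close>

lemma eq_0_if_dvd: assumes "p dvd D p" shows "D p = 0"
proof (rule ccontr)
  assume "D p \<noteq> 0"
  moreover obtain q where q: "D p = p * q"
    using assms by blast
  ultimately have "degree (flow D (D p)) = degree (flow D p) + degree (flow D q)"
    by (auto simp: degree_flow_mult)
  then show False
    using \<open>D p \<noteq> 0\<close> degree_flow_eq_0_iff[of p] by (simp add: degree_flow_D)
qed

text \<open>By the same degree count, \<open>q dvd D p\<close> puts the flow degree of
  \<open>q\<close> strictly below that of \<open>p\<close>, and the other divisibility does the
  converse.\<close>

lemma not_mutually_dvd: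
  assumes "q dvd D p" "p dvd D q" "D p \<noteq> 0" "D q \<noteq> 0"
  shows False
proof -
  have "degree (flow D q) \<le> degree (flow D (D p))" "degree (flow D p) \<le> degree (flow D (D q))"
    using assms by (auto elim!: dvdE simp: degree_flow_mult)
  then show False
    using assms(3,4) degree_flow_eq_0_iff[of p] degree_flow_eq_0_iff[of q]
    unfolding degree_flow_D by linarith
qed

end

section \<open>Components of a locally nilpotent derivation\<close>

text \<open>In characteristic zero the map changes a positive degree by \<open>degree g - 1\<close>,
  which is nonnegative, so the iterates never become constant.\<close>

lemma degree_funpow_mult_pderiv_pos:
  fixes g :: "'b::{idom, ring_char_0} poly"
  assumes "degree g > 0"
  shows "degree (((\<lambda>p. g * pderiv p) ^^ n) [:0, 1:]) > 0"
proof (induction n)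
  case (Suc n)
  define p where "p = ((\<lambda>p. g * pderiv p) ^^ n) [:0, 1:]"
  have "pderiv p \<noteq> 0" "g \<noteq> 0"
    using Suc assms by (auto simp: p_def pderiv_eq_0_iff)
  then have "degree (g * pderiv p) = degree g + degree p - 1"
    using Suc by (simp add: degree_mult_eq degree_pderiv p_def)
  then show ?case
    using Suc assms by (simp add: p_def)
qed simp

context lnd
begin

text \<open>\<open>D\<close> acts on K[x] as \<open>a\<close> times d/dx, and the iterates of that
  map at x do not vanish if \<open>a\<close> has positive degree.\<close>

lemma constant_if_D_var_x_eq:
  assumes "D var_x = [:a:]"
  shows "degree a = 0"
proof (rule ccontr)
  assume "degree a \<noteq> 0"
  have D: "D [:p:] = [:a * pderiv p:]" for p
    by (simp add: W2_apply_poly_x W2 assms)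
  have "(D ^^ n) var_x = [:((\<lambda>p. a * pderiv p) ^^ n) [:0, 1:]:]" for n
    by (induction n) (simp_all add: D var_x_def)
  then have "(D ^^ n) var_x \<noteq> 0" for n
    using degree_funpow_mult_pderiv_pos[of a n] \<open>degree a \<noteq> 0\<close> by auto
  then show False
    using locally_nilpotent by (auto simp: locally_nilpotent_def)
qed

text \<open>\<open>D\<close> is then \<open>D var_y\<close> times \<partial>/\<partial>y over the
  coefficient ring K[x], so the same degree count applies in y.\<close>

lemma D_var_y_if_D_var_x_eq_0:
  assumes "D var_x = 0"
  shows "\<exists>b. D var_y = [:b:]"
proof -
  have "degree (D var_y) = 0"
  proof (rule ccontr)
    assume "degree (D var_y) \<noteq> 0"
    have D: "D p = D var_y * pderiv p" for p
      using W2_apply[OF W2, of p] assms by (simp add: partial_y_def)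
    have "(D ^^ n) var_y = ((\<lambda>p. D var_y * pderiv p) ^^ n) [:0, 1:]" for n
    proof (induction n)
      case (Suc n)
      then show ?case
        using D[of "(D ^^ n) var_y"] by simp
    qed (simp add: var_y_def)
    then have "(D ^^ n) var_y \<noteq> 0" for n
      using degree_funpow_mult_pderiv_pos[of "D var_y" n] \<open>degree (D var_y) \<noteq> 0\<close> by auto
    then show False
      using locally_nilpotent by (auto simp: locally_nilpotent_def)
  qed
  then show ?thesis
    by (metis degree_eq_zeroE)
qed

text \<open>The iterates at y stay of the form p + q y, where q changes to
  \<open>smult \<alpha> (pderiv q) + b1 * q\<close>. If \<open>b1\<close> is nonzero, the first
  summand is zero or of smaller degree than the second, so q never becomes zero.\<close>

lemma no_linear_term_if_D_var_eq:
  assumes "D var_x = const2 \<alpha>" "D var_y = [:b0, b1:]"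
  shows "b1 = 0"
proof (rule ccontr)
  assume b1: "b1 \<noteq> 0"
  have D: "D [:p, q:] = [:smult \<alpha> (pderiv p) + q * b0, smult \<alpha> (pderiv q) + b1 * q:]" for p q
    by (simp add: W2_apply[OF W2, of "[:p, q:]"] assms const2_def partial_x_def partial_y_def map_poly_pCons pderiv_pCons
        mult.commute)
  have "\<exists>p q. (D ^^ n) var_y = [:p, q:] \<and> q \<noteq> 0" for n
  proof (induction n)
    case 0
    show ?case
      by (auto simp: var_y_def)
  next
    case (Suc n)
    then obtain p q where pq: "(D ^^ n) var_y = [:p, q:]" "q \<noteq> 0"
      by blast
    have "smult \<alpha> (pderiv q) + b1 * q \<noteq> 0"
    proof (cases "degree q")
      case 0
      then show ?thesis
        using pq b1 by (simp add: pderiv_eq_0_iff[THEN iffD2])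
    next
      case (Suc k)
      have "degree (smult \<alpha> (pderiv q)) < degree (b1 * q)"
        using Suc b1 pq degree_smult_le[of \<alpha> "pderiv q"] by (simp add: degree_mult_eq degree_pderiv)
      then show ?thesis
        by (metis add_eq_0_iff degree_minus less_irrefl)
    qed
    then show ?case
      by (auto simp: pq D)
  qed
  then show False
    using locally_nilpotent by (metis locally_nilpotent_def pCons_eq_0_iff)
qed

end

subsection \<open>Automorphisms\<close>

lemma algebra_automorphismI:
  assumes "bij \<phi>" "\<phi> 1 = 1" "\<And>p q. \<phi> (p + q) = \<phi> p + \<phi> q" "\<And>p q. \<phi> (p * q) = \<phi> p * \<phi> q"
    "\<And>c p. \<phi> (const2 c * p) = const2 c * \<phi> p"
  shows "algebra_automorphism \<phi>"
  using assms by (simp add: algebra_automorphism_def scale2_conv_const2)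

lemma
  assumes "algebra_automorphism \<phi>"
  shows aut_bij: "bij \<phi>" and aut_1: "\<phi> 1 = 1"
    and aut_add: "\<phi> (p + q) = \<phi> p + \<phi> q" and aut_mult: "\<phi> (p * q) = \<phi> p * \<phi> q"
    and aut_const2_mult: "\<phi> (const2 c * p) = const2 c * \<phi> p"
  using assms unfolding algebra_automorphism_def scale2_conv_const2 by blast+

lemma aut_0: "algebra_automorphism \<phi> \<Longrightarrow> \<phi> 0 = 0"
  using aut_const2_mult[of \<phi> 0 0] by simp

lemma aut_diff: "algebra_automorphism \<phi> \<Longrightarrow> \<phi> (p - q) = \<phi> p - \<phi> q"
  using aut_add[of \<phi> "p - q" q] by (simp add: algebra_simps)

lemma aut_eq_0_iff: "algebra_automorphism \<phi> \<Longrightarrow> \<phi> p = 0 \<longleftrightarrow> p = 0"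
  by (metis aut_0 aut_bij bij_pointE)

lemma aut_inv_apply [simp]:
  "algebra_automorphism \<phi> \<Longrightarrow> inv \<phi> (\<phi> p) = p"
  "algebra_automorphism \<phi> \<Longrightarrow> \<phi> (inv \<phi> p) = p"
  by (simp_all add: aut_bij bij_is_inj bij_is_surj surj_f_inv_f)

lemma aut_inv: assumes "algebra_automorphism \<phi>" shows "algebra_automorphism (inv \<phi>)"
proof (rule algebra_automorphismI)
  have eqI: "inv \<phi> p = q" if "p = \<phi> q" for p q
    using that assms by simp
  show "bij (inv \<phi>)"
    by (simp add: assms aut_bij bij_imp_bij_inv)
  show "inv \<phi> 1 = 1" "inv \<phi> (p + q) = inv \<phi> p + inv \<phi> q" "inv \<phi> (p * q) = inv \<phi> p * inv \<phi> q"
    "inv \<phi> (const2 c * p) = const2 c * inv \<phi> p" for p q c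
    by ((rule eqI, simp add: assms aut_1), (rule eqI, simp add: assms aut_add),
        (rule eqI, simp add: assms aut_mult), (rule eqI, simp add: assms aut_const2_mult))
qed

lemma aut_comp:
  assumes "algebra_automorphism \<phi>" "algebra_automorphism \<psi>"
  shows "algebra_automorphism (\<phi> \<circ> \<psi>)"
proof (rule algebra_automorphismI)
  show "(\<phi> \<circ> \<psi>) (const2 c * p) = const2 c * (\<phi> \<circ> \<psi>) p" for c p
    by (simp add: assms aut_const2_mult)
qed (simp_all add: assms bij_comp aut_bij aut_1 aut_add aut_mult)

lemma aut_id: "algebra_automorphism id"
  by (intro algebra_automorphismI) simp_all

section \<open>Conjugation by automorphisms\<close>

definition conj_der ::
  "('a::field poly poly \<Rightarrow> 'a poly poly) \<Rightarrow> ('a poly poly \<Rightarrow> 'a poly poly) \<Rightarrow> 'a poly poly \<Rightarrow> 'a poly poly"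
  where "conj_der \<phi> D = \<phi> \<circ> D \<circ> inv \<phi>"

lemma conjugate_eq: "conjugate \<phi> L = conj_der \<phi> ` L"
  by (simp add: conjugate_def conj_der_def)

lemma conj_der_comp:
  assumes "algebra_automorphism \<phi>" "algebra_automorphism \<psi>"
  shows "conj_der (\<phi> \<circ> \<psi>) D = conj_der \<phi> (conj_der \<psi> D)"
  using assms by (simp add: conj_der_def o_inv_distrib aut_bij o_assoc)

lemma conj_der_id [simp]: "conj_der id D = D"
  by (simp add: conj_der_def)

lemma conj_der_in_W2:
  assumes "algebra_automorphism \<phi>" "D \<in> W2"
  shows "conj_der \<phi> D \<in> W2"
proof (rule W2I)
  note simps = assms aut_inv[OF assms(1)] conj_der_def
  show "conj_der \<phi> D (p + q) = conj_der \<phi> D p + conj_der \<phi> D q" for p q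
    by (simp add: simps aut_add W2_add)
  show "conj_der \<phi> D (const2 c * p) = const2 c * conj_der \<phi> D p" for c p
    by (simp add: simps aut_const2_mult W2_const2_mult)
  show "conj_der \<phi> D (p * q) = conj_der \<phi> D p * q + p * conj_der \<phi> D q" for p q
    by (simp add: simps aut_add aut_mult W2_mult)
qed

lemma conj_der_funpow:
  assumes "algebra_automorphism \<phi>"
  shows "(conj_der \<phi> D ^^ n) p = \<phi> ((D ^^ n) (inv \<phi> p))"
  by (induction n) (simp_all add: conj_der_def assms)

lemma lnd_conj_der:
  assumes "algebra_automorphism \<phi>" "lnd D"
  shows "lnd (conj_der \<phi> D)"
  using assms unfolding lnd_def locally_nilpotent_def
  by (auto simp: conj_der_in_W2 conj_der_funpow aut_eq_0_iff)

text \<open>Each coefficient of the conjugated flow is the image under \<open>\<phi>\<close> of the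
  coefficient for \<open>D\<close> at \<open>inv \<phi> p\<close>, so both flows are nonzero in the
  same places.\<close>

lemma degree_flow_conj_der:
  assumes "algebra_automorphism \<phi>" "lnd D"
  shows "degree (flow (conj_der \<phi> D) p) = degree (flow D (inv \<phi> p))"
proof -
  have "coeff (flow (conj_der \<phi> D) p) k = 0 \<longleftrightarrow> coeff (flow D (inv \<phi> p)) k = 0" for k
    using assms
    by (simp add: lnd.coeff_flow lnd_conj_der conj_der_funpow aut_eq_0_iff)
  then show ?thesis
    by (simp add: degree_def)
qed

lemma lie_bracket_conj_der:
  assumes "algebra_automorphism \<phi>"
  shows "lie_bracket (conj_der \<phi> D) (conj_der \<phi> E) = conj_der \<phi> (lie_bracket D E)"
  by (simp add: fun_eq_iff lie_bracket_def conj_der_def assms aut_diff)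

lemma lie_subalgebra_conjugate:
  assumes \<phi>: "algebra_automorphism \<phi>" and L: "lie_subalgebra L W2"
  shows "lie_subalgebra (conjugate \<phi> L) W2"
proof -
  have 0: "(\<lambda>p. 0) = conj_der \<phi> (\<lambda>p. 0)"
    and add: "(\<lambda>p. conj_der \<phi> D p + conj_der \<phi> E p) = conj_der \<phi> (\<lambda>p. D p + E p)"
    and scale: "(\<lambda>p. scale2 c (conj_der \<phi> D p)) = conj_der \<phi> (\<lambda>p. scale2 c (D p))" for D E c
    using \<phi> by (simp_all add: conj_der_def fun_eq_iff aut_0 aut_add scale2_conv_const2 aut_const2_mult)
  show ?thesis
    unfolding lie_subalgebra_def conjugate_eq
  proof (intro conjI ballI allI)
    show "conj_der \<phi> ` L \<subseteq> W2"
      using L \<phi> by (auto simp: lie_subalgebra_def conj_der_in_W2)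
    show "(\<lambda>p. 0) \<in> conj_der \<phi> ` L"
      using L by (subst 0, intro imageI) (simp add: lie_subalgebra_def)
  next
    fix D' E' assume "D' \<in> conj_der \<phi> ` L" "E' \<in> conj_der \<phi> ` L"
    then obtain D E where DE: "D' = conj_der \<phi> D" "E' = conj_der \<phi> E" "D \<in> L" "E \<in> L"
      by blast
    show "(\<lambda>p. D' p + E' p) \<in> conj_der \<phi> ` L" "lie_bracket D' E' \<in> conj_der \<phi> ` L"
      using L DE(3,4) unfolding DE(1,2) add lie_bracket_conj_der[OF \<phi>] lie_subalgebra_def by blast+
  next
    fix c D' assume "D' \<in> conj_der \<phi> ` L"
    then obtain D where D: "D' = conj_der \<phi> D" "D \<in> L"
      by blast
    show "(\<lambda>p. scale2 c (D' p)) \<in> conj_der \<phi> ` L"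
      using L D(2) unfolding D(1) scale lie_subalgebra_def by blast
  qed
qed

lemma conjugate_comp:
  assumes "algebra_automorphism \<phi>" "algebra_automorphism \<psi>"
  shows "conjugate (\<phi> \<circ> \<psi>) L = conjugate \<phi> (conjugate \<psi> L)"
  using assms by (simp add: conjugate_eq image_image conj_der_comp)

section \<open>Shears and the exchange of the variables\<close>

text \<open>Substitution of y + s(x) for y; x is fixed.\<close>

definition shear :: "'a::field poly \<Rightarrow> 'a poly poly \<Rightarrow> 'a poly poly" where
  "shear s p = pcompose p [:s, 1:]"

lemma shear_shear: "shear s (shear t p) = shear (s + t) p"
  by (simp add: shear_def pcompose_assoc[symmetric] pcompose_pCons add.commute)

lemma shear_0 [simp]: "shear 0 p = p"
  by (simp add: shear_def)

lemma shear_var [simp]: "shear s var_x = var_x" "shear s var_y = var_y + [:s:]"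
  by (simp_all add: shear_def var_x_def var_y_def pcompose_pCons)

lemma shear_automorphism: "algebra_automorphism (shear s)"
proof (rule algebra_automorphismI)
  show "bij (shear s)"
    by (rule o_bij[of "shear (- s)"]) (simp_all add: fun_eq_iff shear_shear)
qed (simp_all add: shear_def const2_def pcompose_1 pcompose_add pcompose_mult pcompose_smult)

lemma inv_shear: "inv (shear s) = shear (- s)"
  by (rule inv_equality) (simp_all add: shear_shear)

definition swap_xy :: "'a::field poly poly \<Rightarrow> 'a poly poly" where
  "swap_xy p = (\<Sum>(i, j)\<in>{(i, j). cf p i j \<noteq> 0}. const2 (cf p i j) * (var_x ^ j * var_y ^ i))"

lemma cf_swap_xy [simp]: "cf (swap_xy p) i j = cf p j i"
proof -
  have "cf (swap_xy p) i j
      = (\<Sum>s\<in>{(i, j). cf p i j \<noteq> 0}. if s = (j, i) then cf p j i else 0)"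
    unfolding swap_xy_def cf_sum by (intro sum.cong) (auto simp: cf_monomial split: if_splits)
  also have "\<dots> = cf p j i"
    by (simp add: sum.delta finite_support)
  finally show ?thesis .
qed

lemma swap_xy_swap_xy [simp]: "swap_xy (swap_xy p) = p"
  by (rule cf_eqI) simp

lemma swap_xy_var [simp]: "swap_xy var_x = var_y" "swap_xy var_y = var_x"
  by (rule cf_eqI, simp add: cf_var_x cf_var_y)+

lemma inv_swap_xy: "inv swap_xy = swap_xy"
  by (rule inv_equality) simp_all

lemma swap_xy_automorphism: "algebra_automorphism swap_xy"
proof (rule algebra_automorphismI)
  show "bij swap_xy"
    by (rule o_bij[of swap_xy]) (simp_all add: fun_eq_iff)
  show "swap_xy 1 = (1 :: 'a poly poly)"
    by (rule cf_eqI) (simp add: cf_monomial[of 0 0, simplified])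
  show "swap_xy (p * q) = swap_xy p * swap_xy q" for p q :: "'a poly poly"
    by (rule cf_eqI, simp only: cf_swap_xy cf_mult, rule sum.swap)
qed (rule cf_eqI, simp)+

subsection \<open>Weighted degrees\<close>

context
  fixes n m :: nat
begin

text \<open>Integer-valued, since the bounds for derivatives subtract \<open>n\<close> or
  \<open>m\<close> and may become negative.\<close>

definition weight :: "nat \<Rightarrow> nat \<Rightarrow> int" where
  "weight i j = int n * int i + int m * int j"

text \<open>A bound instead of a degree, so that the zero polynomial satisfies it for every
  \<open>N\<close>.\<close>

definition wdeg_le :: "int \<Rightarrow> 'a::field poly poly \<Rightarrow> bool" where
  "wdeg_le N p \<longleftrightarrow> (\<forall>i j. cf p i j \<noteq> 0 \<longrightarrow> weight i j \<le> N)"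

definition hcomp :: "int \<Rightarrow> 'a::field poly poly \<Rightarrow> 'a poly poly" where
  "hcomp N p = (\<Sum>(i, j)\<in>{(i, j). cf p i j \<noteq> 0}.
     const2 (if weight i j = N then cf p i j else 0) * (var_x ^ i * var_y ^ j))"

lemma cf_hcomp [simp]: "cf (hcomp N p) i j = (if weight i j = N then cf p i j else 0)"
proof -
  have "cf (hcomp N p) i j
      = (\<Sum>s\<in>{(i, j). cf p i j \<noteq> 0}. if s = (i, j) then (if weight i j = N then cf p i j else 0) else 0)"
    unfolding hcomp_def cf_sum by (intro sum.cong) (auto simp: cf_monomial split: if_splits)
  then show ?thesis
    by (simp add: sum.delta finite_support)
qed

lemma wdeg_le_monomial: "wdeg_le (weight i j) (var_x ^ i * var_y ^ j)"
  by (simp add: wdeg_le_def cf_monomial)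

lemma hcomp_monomial [simp]: "hcomp (weight i j) (var_x ^ i * var_y ^ j) = var_x ^ i * var_y ^ j"
  by (rule cf_eqI) (simp add: cf_monomial)

lemma hcomp_0 [simp]: "hcomp N 0 = 0"
  by (rule cf_eqI) simp

lemma hcomp_add: "hcomp N (p + q) = hcomp N p + hcomp N q"
  by (rule cf_eqI) simp

lemma wdeg_le_add: "wdeg_le N p \<Longrightarrow> wdeg_le N q \<Longrightarrow> wdeg_le N (p + q)"
  unfolding wdeg_le_def cf_add by (metis add.right_neutral)

lemma weight_split:
  "k \<le> j \<Longrightarrow> l \<le> i \<Longrightarrow> weight i j = weight l k + weight (i - l) (j - k)"
  by (simp add: weight_def of_nat_diff algebra_simps)

lemma wdeg_le_mult:
  assumes "wdeg_le N p" "wdeg_le M q"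
  shows "wdeg_le (N + M) (p * q)"
  unfolding wdeg_le_def
proof (intro allI impI)
  fix i j
  assume "cf (p * q) i j \<noteq> 0"
  then obtain k where "k \<le> j" "(\<Sum>l\<le>i. cf p l k * cf q (i - l) (j - k)) \<noteq> 0"
    unfolding cf_mult by (metis (no_types, lifting) atMost_iff sum.neutral)
  then obtain l where "l \<le> i" "cf p l k * cf q (i - l) (j - k) \<noteq> 0"
    by (metis (no_types, lifting) atMost_iff sum.neutral)
  then have "weight l k \<le> N" "weight (i - l) (j - k) \<le> M"
    using assms by (auto simp: wdeg_le_def)
  then show "weight i j \<le> N + M"
    using weight_split[OF \<open>k \<le> j\<close> \<open>l \<le> i\<close>] by linarith
qed

text \<open>A product monomial reaches weight \<open>N + M\<close> only if both factors contribute
  monomials that attain their bounds.\<close>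

lemma hcomp_mult:
  assumes "wdeg_le N p" "wdeg_le M q"
  shows "hcomp (N + M) (p * q) = hcomp N p * hcomp M q"
proof (rule cf_eqI)
  fix i j
  have "(if weight i j = N + M then cf p l k * cf q (i - l) (j - k) else 0)
      = cf (hcomp N p) l k * cf (hcomp M q) (i - l) (j - k)" if "k \<le> j" "l \<le> i" for k l
  proof -
    have "cf p l k = 0 \<or> weight l k \<le> N" "cf q (i - l) (j - k) = 0 \<or> weight (i - l) (j - k) \<le> M"
      using assms by (auto simp: wdeg_le_def)
    then show ?thesis
      using weight_split[OF that] by auto
  qed
  then have "cf (hcomp N p * hcomp M q) i j = (\<Sum>k\<le>j. \<Sum>l\<le>i.
      if weight i j = N + M then cf p l k * cf q (i - l) (j - k) else 0)"
    unfolding cf_mult by (intro sum.cong refl) (metis atMost_iff)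
  then show "cf (hcomp (N + M) (p * q)) i j = cf (hcomp N p * hcomp M q) i j"
    by (cases "weight i j = N + M") (simp_all add: cf_mult)
qed

lemma wdeg_le_partial_x: "wdeg_le N p \<Longrightarrow> wdeg_le (N - int n) (partial_x p)"
  and wdeg_le_partial_y: "wdeg_le N p \<Longrightarrow> wdeg_le (N - int m) (partial_y p)"
proof -
  assume "wdeg_le N p"
  then have le: "weight i j \<le> N" if "cf p i j \<noteq> 0" for i j
    using that by (simp add: wdeg_le_def)
  have "weight i j \<le> N - int n \<longleftrightarrow> weight (Suc i) j \<le> N"
    "weight i j \<le> N - int m \<longleftrightarrow> weight i (Suc j) \<le> N" for i j
    by (auto simp: weight_def distrib_left)
  then show "wdeg_le (N - int n) (partial_x p)" "wdeg_le (N - int m) (partial_y p)"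
    unfolding wdeg_le_def cf_partial_x cf_partial_y by (auto intro: le)
qed

lemma hcomp_partial_x: "hcomp (N - int n) (partial_x p) = partial_x (hcomp N p)"
  and hcomp_partial_y: "hcomp (N - int m) (partial_y p) = partial_y (hcomp N p)"
  by (rule cf_eqI, auto simp: cf_partial_x cf_partial_y weight_def algebra_simps)+

section \<open>The top homogeneous part of a derivation\<close>

context
  fixes D :: "'a::field_char_0 poly poly \<Rightarrow> 'a poly poly" and d :: nat
  assumes D: "D \<in> W2"
    and Dx: "wdeg_le (int n + int d) (D var_x)" and Dy: "wdeg_le (int m + int d) (D var_y)"
begin

text \<open>The assumptions say that \<open>D\<close> raises weights by at most \<open>d\<close>;
  this is the part raising them by exactly \<open>d\<close>.\<close>

definition top_der :: "'a poly poly \<Rightarrow> 'a poly poly" where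
  "top_der = der (hcomp (int n + int d) (D var_x)) (hcomp (int m + int d) (D var_y))"

lemma top_der_in_W2: "top_der \<in> W2"
  by (simp add: top_der_def der_in_W2)

lemma wdeg_le_D:
  assumes "wdeg_le N p" shows "wdeg_le (N + int d) (D p)"
proof -
  have "wdeg_le (N + int d) (D var_x * partial_x p)" "wdeg_le (N + int d) (D var_y * partial_y p)"
    using wdeg_le_mult[OF Dx wdeg_le_partial_x[OF assms]] wdeg_le_mult[OF Dy wdeg_le_partial_y[OF assms]]
    by (simp_all add: algebra_simps)
  then show ?thesis
    unfolding W2_apply[OF D, of p] by (rule wdeg_le_add)
qed

lemma hcomp_D:
  assumes "wdeg_le N p" shows "hcomp (N + int d) (D p) = top_der (hcomp N p)"
  using hcomp_mult[OF Dx wdeg_le_partial_x[OF assms]] hcomp_mult[OF Dy wdeg_le_partial_y[OF assms]]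
  by (simp add: W2_apply[OF D, of p] hcomp_add hcomp_partial_x hcomp_partial_y top_der_def der_def
      algebra_simps)

lemma hcomp_funpow_D:
  assumes "wdeg_le N p"
  shows "hcomp (N + int (k * d)) ((D ^^ k) p) = (top_der ^^ k) (hcomp N p)
    \<and> wdeg_le (N + int (k * d)) ((D ^^ k) p)"
proof (induction k)
  case (Suc k)
  have eq: "N + int (Suc k * d) = N + int (k * d) + int d"
    by simp
  show ?case
    unfolding eq using Suc hcomp_D wdeg_le_D by simp
qed (simp add: assms)

text \<open>On a monomial the iterates of \<open>top_der\<close> are homogeneous components of the
  iterates of \<open>D\<close>, by \<open>hcomp_funpow_D\<close>, so they vanish eventually. For a
  sum the two exponents are added.\<close>

lemma lnd_top_der:
  assumes "locally_nilpotent D"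
  shows "lnd top_der"
proof
  have stable: "(top_der ^^ l) p = 0" if "(top_der ^^ k) p = 0" "k \<le> l" for k l p
  proof -
    have "(top_der ^^ l) p = (top_der ^^ (l - k)) ((top_der ^^ k) p)"
      using that funpow_add[of "l - k" k top_der] by simp
    then show ?thesis
      by (simp add: that W2_funpow_0 top_der_in_W2)
  qed
  have "\<exists>k. (top_der ^^ k) p = 0" for p
  proof (induction p rule: poly2_induct)
    case (monomial c i j)
    obtain k where "(D ^^ k) (var_x ^ i * var_y ^ j) = 0"
      using assms by (auto simp: locally_nilpotent_def)
    then have "(top_der ^^ k) (var_x ^ i * var_y ^ j) = 0"
      using hcomp_funpow_D[OF wdeg_le_monomial, of i j k] by simp
    then show ?case
      by (metis W2_funpow_const2_mult mult_zero_right top_der_in_W2)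
  next
    case (add p q)
    then obtain k l where "(top_der ^^ k) p = 0" "(top_der ^^ l) q = 0"
      by blast
    then have "(top_der ^^ (k + l)) (p + q) = 0"
      using stable[of k p "k + l"] stable[of l q "k + l"] by (simp add: W2_funpow_add top_der_in_W2)
    then show ?case ..
  qed
  then show "locally_nilpotent top_der"
    unfolding locally_nilpotent_def using stable by (metis le_SucI order_refl zero_less_Suc)
qed (rule top_der_in_W2)

end

section \<open>Leading coefficients of flows\<close>

text \<open>The value of the weight-\<open>N\<close> component of \<open>p\<close> at x =
  \<open>a\<close>, y = \<open>b\<close>. The index set is independent of \<open>p\<close>, and
  finite for positive \<open>n\<close> and \<open>m\<close>.\<close>

definition evalw :: "nat \<Rightarrow> 'a::field poly poly \<Rightarrow> 'a poly poly \<Rightarrow> 'a poly poly \<Rightarrow> 'a poly poly" where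
  "evalw N a b p = (\<Sum>(i, j)\<in>{(i, j). n * i + m * j = N}. const2 (cf p i j) * (a ^ i * b ^ j))"

lemma weight_eq_int_iff: "weight i j = int N \<longleftrightarrow> n * i + m * j = N"
  unfolding weight_def by (metis of_nat_add of_nat_eq_iff of_nat_mult)

lemma weight_le_int_iff: "weight i j \<le> int N \<longleftrightarrow> n * i + m * j \<le> N"
  unfolding weight_def by (metis of_nat_add of_nat_le_iff of_nat_mult)

lemma finite_weight_eq:
  assumes "n > 0" "m > 0"
  shows "finite {(i, j). n * i + m * j = N}"
proof (rule finite_subset)
  show "{(i, j). n * i + m * j = N} \<subseteq> {..N} \<times> {..N}"
  proof clarsimp
    fix i j
    have "i \<le> n * i" "j \<le> m * j"
      using assms by simp_all
    then show "i \<le> n * i + m * j \<and> j \<le> n * i + m * j"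
      by linarith
  qed
qed simp

end

text \<open>The flow of x^i y^j has degree n i + m j and leading coefficient a^i b^j, with a and b
  the leading coefficients for x and y. As no weight exceeds \<open>N\<close>, only monomials of
  weight exactly \<open>N\<close> reach the coefficient of t^N.\<close>

lemma (in lnd) coeff_flow_conv_evalw:
  assumes n: "n = degree (flow D var_x)" "n > 0" and m: "m = degree (flow D var_y)" "m > 0"
    and N: "wdeg_le n m (int N) p"
  shows "coeff (flow D p) N = evalw n m N (lead_coeff (flow D var_x)) (lead_coeff (flow D var_y)) p"
proof -
  define a where "a = lead_coeff (flow D var_x)"
  define b where "b = lead_coeff (flow D var_y)"
  define E where "E i j = flow D (var_x ^ i * var_y ^ j)" for i j
  define S where "S = {(i, j). cf p i j \<noteq> 0}"
  define T where "T = {(i, j). n * i + m * j = N}"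
  have E: "degree (E i j) = n * i + m * j" "lead_coeff (E i j) = a ^ i * b ^ j" for i j
    by (simp add: E_def flow_mult flow_power degree_mult_eq degree_power_eq n m mult.commute)
      (simp only: E_def flow_mult flow_power lead_coeff_mult lead_coeff_power a_def b_def)
  have coeff_E: "const2 (cf p i j) * coeff (E i j) N =
      (if (i, j) \<in> T then const2 (cf p i j) * (a ^ i * b ^ j) else 0)" for i j
  proof (cases "cf p i j = 0")
    case False
    then have "n * i + m * j \<le> N"
      using N by (simp add: wdeg_le_def weight_le_int_iff)
    then show ?thesis
      using E[of i j] by (auto simp: T_def coeff_eq_0)
  qed simp
  have p: "p = (\<Sum>(i, j)\<in>S. const2 (cf p i j) * (var_x ^ i * var_y ^ j))"
    by (rule monomial_expansion) (auto simp: S_def finite_support)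
  have "flow D p = (\<Sum>(i, j)\<in>S. smult (const2 (cf p i j)) (E i j))"
    by (subst p) (simp only: flow_sum flow_const2_mult E_def prod.case_distrib[of "flow D"])
  then have "coeff (flow D p) N = (\<Sum>(i, j)\<in>S. const2 (cf p i j) * coeff (E i j) N)"
    by (simp add: coeff_sum prod.case_distrib[of "\<lambda>q. coeff q N"])
  also have "\<dots> = (\<Sum>s\<in>S. if s \<in> T then (case s of (i, j) \<Rightarrow> const2 (cf p i j) * (a ^ i * b ^ j)) else 0)"
    by (intro sum.cong) (auto simp: coeff_E)
  also have "\<dots> = (\<Sum>(i, j)\<in>S \<inter> T. const2 (cf p i j) * (a ^ i * b ^ j))"
    by (rule sum.inter_restrict[symmetric]) (simp add: S_def finite_support)
  also have "\<dots> = (\<Sum>(i, j)\<in>T. const2 (cf p i j) * (a ^ i * b ^ j))"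
    by (rule sum.mono_neutral_left) (use finite_weight_eq[OF n(2) m(2)] in \<open>auto simp: S_def T_def\<close>)
  finally show ?thesis
    by (simp add: evalw_def T_def a_def b_def)
qed

text \<open>For \<open>k > N\<close> also \<open>k\<close> bounds the weights, and the component of
  weight \<open>k\<close> is zero, so \<open>coeff_flow_conv_evalw\<close> makes the coefficient at
  \<open>k\<close> vanish.\<close>

lemma (in lnd) degree_flow_le:
  assumes n: "n = degree (flow D var_x)" "n > 0" and m: "m = degree (flow D var_y)" "m > 0"
    and N: "wdeg_le n m (int N) p"
  shows "degree (flow D p) \<le> N"
proof (rule degree_le, intro allI impI)
  fix k assume "k > N"
  have cf: "cf p i j = 0" if "n * i + m * j = k" for i j
    using N that \<open>k > N\<close> unfolding wdeg_le_def weight_le_int_iff by (metis leD)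
  have "wdeg_le n m (int k) p"
    using N \<open>k > N\<close> by (fastforce simp: wdeg_le_def)
  from coeff_flow_conv_evalw[OF n m this] show "coeff (flow D p) k = 0"
    by (simp add: evalw_def, intro sum.neutral) (auto simp: cf)
qed

subsection \<open>Weighted homogeneous polynomials split into binomials\<close>

text \<open>For \<open>degree h \<le> r\<close>, the homogenization of \<open>h\<close> in degree
  \<open>r\<close>, evaluated at \<open>(a, b)\<close>.\<close>

definition hform :: "nat \<Rightarrow> 'a::field poly \<Rightarrow> 'a poly poly \<Rightarrow> 'a poly poly \<Rightarrow> 'a poly poly" where
  "hform r h a b = (\<Sum>k\<le>r. const2 (coeff h k) * (a ^ k * b ^ (r - k)))"

lemma hform_linear_factor:
  assumes "degree h \<le> r"
  shows "hform (Suc r) ([:- c, 1:] * h) a b = (a - const2 c * b) * hform r h a b"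
proof -
  have "hform (Suc r) ([:- c, 1:] * h) a b =
      (\<Sum>k\<le>Suc r. const2 (coeff (pCons 0 h) k) * (a ^ k * b ^ (Suc r - k)))
      - const2 c * (\<Sum>k\<le>Suc r. const2 (coeff h k) * (a ^ k * b ^ (Suc r - k)))"
    unfolding hform_def sum_distrib_left sum_subtractf[symmetric]
    by (intro sum.cong) (simp_all add: const2_diff const2_mult algebra_simps)
  also have "(\<Sum>k\<le>Suc r. const2 (coeff (pCons 0 h) k) * (a ^ k * b ^ (Suc r - k))) = a * hform r h a b"
    unfolding sum.atMost_Suc_shift hform_def sum_distrib_left by (simp add: algebra_simps)
  also have "(\<Sum>k\<le>Suc r. const2 (coeff h k) * (a ^ k * b ^ (Suc r - k))) = b * hform r h a b"
    using assms by (simp add: coeff_eq_0 hform_def sum_distrib_left Suc_diff_le algebra_simps)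
  finally show ?thesis
    by (simp add: algebra_simps)
qed

text \<open>Over an algebraically closed field \<open>h\<close> splits, so its form is a product of
  factors \<open>a - const2 c * b\<close> for roots \<open>c\<close> and a nonzero multiple of a
  power of \<open>b\<close>; one linear factor has to vanish.\<close>

lemma hform_eq_0_imp_root:
  fixes h :: "'a::alg_closed_field poly"
  assumes "hform r h a b = 0" "b \<noteq> 0" "h \<noteq> 0" "degree h \<le> r"
  shows "\<exists>c. a = const2 c * b \<and> poly h c = 0"
  using assms
proof (induction "degree h" arbitrary: h r)
  case 0
  then obtain c where "h = [:c:]" "c \<noteq> 0"
    by (metis degree_eq_zeroE pCons_0_0)
  moreover have "hform r [:c:] a b = const2 c * b ^ r"
    unfolding hform_def by (subst sum.atMost_shift) (simp_all)
  ultimately show ?case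
    using 0 by simp
next
  case (Suc e)
  then obtain c where "poly h c = 0"
    by (metis alg_closed_imp_poly_has_root zero_less_Suc)
  then obtain h' where h: "h = [:- c, 1:] * h'"
    by (metis dvdE poly_eq_0_iff_dvd)
  then have "h' \<noteq> 0"
    using Suc.prems by auto
  then have "degree h = Suc (degree h')"
    unfolding h by (subst degree_mult_eq) auto
  moreover obtain r' where "r = Suc r'"
    using Suc.hyps(2) Suc.prems(4) by (cases r) auto
  ultimately have "(a - const2 c * b) * hform r' h' a b = 0" "degree h' = e" "degree h' \<le> r'"
    using Suc.prems Suc.hyps(2) hform_linear_factor[of h' r' c a b] h by auto
  then consider "a = const2 c * b" | "hform r' h' a b = 0"
    by auto
  then show ?case
  proof cases
    case 1
    then show ?thesis
      using \<open>poly h c = 0\<close> by blast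
  next
    case 2
    then show ?thesis
      using Suc.hyps(1)[of h' r'] \<open>degree h' = e\<close> \<open>degree h' \<le> r'\<close> \<open>h' \<noteq> 0\<close> Suc.prems(2)
      by (auto simp: h)
  qed
qed

lemma dvd_hform_if_root:
  assumes "poly h c = 0" "h \<noteq> 0" "degree h \<le> r"
  shows "(a - const2 c * b) dvd hform r h a b"
proof -
  obtain h' where h: "h = [:- c, 1:] * h'"
    using assms(1) by (metis dvdE poly_eq_0_iff_dvd)
  then have "h' \<noteq> 0"
    using assms by auto
  then have "degree h = Suc (degree h')"
    unfolding h by (subst degree_mult_eq) auto
  then obtain r' where "r = Suc r'" "degree h' \<le> r'"
    using assms(3) by (cases r) auto
  then show ?thesis
    by (simp only: h hform_linear_factor dvd_triv_left)
qed

text \<open>Two solutions differ by a multiple of (t, -s), which keeps the residues and shifts the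
  two quotients by opposite amounts.\<close>

lemma coprime_linear_solutions:
  fixes s t :: nat
  assumes "coprime s t" "s > 0" "t > 0" and eq: "s * i + t * j = s * i' + t * j'"
  shows "i mod t = i' mod t" "i div t + j div s = i' div t + j' div s"
proof -
  \<comment> \<open>The general form also serves for \<open>j\<close>, with \<open>s\<close> and
    \<open>t\<close> exchanged.\<close>
  have mod: "i mod t = i' mod t" if "coprime s t" "s * i + t * j = s * i' + t * j'" for s t i i' j j' :: nat
  proof -
    have "int s * (int i - int i') = int t * (int j' - int j)"
      using arg_cong[OF that(2), of int] by (simp add: algebra_simps)
    then have "int t dvd int s * (int i - int i')"
      by simp
    then have "int t dvd int i - int i'"
      using that(1) by (simp add: coprime_dvd_mult_right_iff coprime_commute)
    then have "int i mod int t = int i' mod int t"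
      by (simp add: mod_eq_dvd_iff)
    then show ?thesis
      by (metis of_nat_eq_iff zmod_int)
  qed
  show i: "i mod t = i' mod t"
    using mod[OF assms(1) eq] .
  have j: "j mod s = j' mod s"
    using mod[of t s j i j' i'] assms by (simp add: coprime_commute add.commute)
  have expand: "s * k + t * l = (s * (k mod t) + t * (l mod s)) + (s * t) * (k div t + l div s)" for k l
  proof -
    have "s * k + t * l = s * (k mod t + t * (k div t)) + t * (l mod s + s * (l div s))"
      by simp
    then show ?thesis
      by (simp only: algebra_simps)
  qed
  have "(s * t) * (i div t + j div s) = (s * t) * (i' div t + j' div s)"
    using eq unfolding expand[of i j] expand[of i' j'] i j by simp
  then show "i div t + j div s = i' div t + j' div s"
    using assms by simp
qed

text \<open>The exponents of one weight form a chain with step (t, -s), so \<open>p\<close> is a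
  monomial times a form in x^t and y^s. A zero of this form at (a^t, b^s) comes from a root of a
  univariate polynomial, and that root yields both the relation and the binomial factor.\<close>

lemma vanishing_weighted_homogeneous:
  fixes p :: "'a::alg_closed_field poly poly"
  assumes st: "coprime s t" "s > 0" "t > 0" "g > 0"
    and hom: "\<And>i j. cf p i j \<noteq> 0 \<Longrightarrow> g * s * i + g * t * j = N"
    and "p \<noteq> 0" "evalw (g * s) (g * t) N a b p = 0" "a \<noteq> 0" "b \<noteq> 0"
  shows "\<exists>c. a ^ t = const2 c * b ^ s \<and> (var_x ^ t - const2 c * var_y ^ s) dvd p"
proof -
  define T where "T = {(i, j). g * s * i + g * t * j = N}"
  have fin: "finite T"
    unfolding T_def by (rule finite_weight_eq) (use st in auto)
  obtain i1 j1 where cf1: "cf p i1 j1 \<noteq> 0"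
    using \<open>p \<noteq> 0\<close> cf_eqI[of p 0] by auto
  \<comment> \<open>By \<open>coprime_linear_solutions\<close> these numbers are the same for every
    exponent pair of the weight; the chain has \<open>r + 1\<close> points, enumerated by
    \<open>f\<close>.\<close>
  define i0 j0 r where "i0 = i1 mod t" and "j0 = j1 mod s" and "r = i1 div t + j1 div s"
  define f where "f k = (i0 + t * k, j0 + s * (r - k))" for k
  have N: "N = g * (s * i1 + t * j1)"
    using hom[OF cf1] by (simp add: algebra_simps)
  have T_iff: "(i, j) \<in> T \<longleftrightarrow> s * i + t * j = s * i1 + t * j1" for i j
  proof -
    have "(i, j) \<in> T \<longleftrightarrow> g * (s * i + t * j) = g * (s * i1 + t * j1)"
      by (simp add: T_def N algebra_simps)
    then show ?thesis
      using \<open>g > 0\<close> by simp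
  qed
  have f_div: "s * i1 + t * j1 = s * (i0 + t * k) + t * (j0 + s * (r - k))" if "k \<le> r" for k
  proof -
    have "s * (i0 + t * k) + t * (j0 + s * (r - k)) = s * i0 + t * j0 + s * t * (k + (r - k))"
      by (simp add: algebra_simps)
    also have "\<dots> = s * (i0 + t * (i1 div t)) + t * (j0 + s * (j1 div s))"
      using that by (simp add: r_def algebra_simps)
    finally show ?thesis
      by (simp add: i0_def j0_def)
  qed
  have T: "T = f ` {..r}"
  proof (intro equalityI subsetI)
    fix x assume "x \<in> T"
    then obtain i j where x: "x = (i, j)" "s * i + t * j = s * i1 + t * j1"
      by (cases x) (auto simp: T_iff)
    note sol = coprime_linear_solutions[OF st(1-3) x(2)]
    have "j mod s = j0"
      using coprime_linear_solutions(1)[of t s j i j1 i1] st x(2)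
      by (simp add: coprime_commute add.commute j0_def)
    moreover have "r - i div t = j div s"
      using sol(2) by (simp add: r_def)
    ultimately have "x = f (i div t)"
      using sol(1) by (simp add: f_def x i0_def) (metis mod_mult_div_eq)
    moreover have "i div t \<le> r"
      using sol(2) by (simp add: r_def)
    ultimately show "x \<in> f ` {..r}"
      by blast
  qed (auto simp: f_def T_iff f_div)
  have inj: "inj_on f {..r}"
    using st by (auto simp: f_def inj_on_def)
  define h where "h = (\<Sum>k\<le>r. monom (cf p (fst (f k)) (snd (f k))) k)"
  have coeff_h: "coeff h k = (if k \<le> r then cf p (fst (f k)) (snd (f k)) else 0)" for k
    by (simp add: h_def coeff_sum if_distrib cong: if_cong)
  have deg: "degree h \<le> r"
    by (rule degree_le) (simp add: coeff_h)
  \<comment> \<open>Used twice: at the variables it gives \<open>p\<close> back, at \<open>a\<close>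
    and \<open>b\<close> it gives \<open>evalw\<close>.\<close>
  have eval: "(\<Sum>(i, j)\<in>T. const2 (cf p i j) * (A ^ i * B ^ j))
      = A ^ i0 * B ^ j0 * hform r h (A ^ t) (B ^ s)" for A B
    unfolding T sum.reindex[OF inj] hform_def sum_distrib_left
    by (intro sum.cong) (simp_all add: f_def coeff_h power_add power_mult mult.left_commute mult.assoc)
  have p: "p = var_x ^ i0 * var_y ^ j0 * hform r h (var_x ^ t) (var_y ^ s)"
    unfolding eval[symmetric] by (rule monomial_expansion) (use hom fin in \<open>auto simp: T_def\<close>)
  have "h \<noteq> 0"
    using \<open>p \<noteq> 0\<close> p by (auto simp: hform_def)
  have "a ^ i0 * b ^ j0 * hform r h (a ^ t) (b ^ s) = 0"
    using assms(7) unfolding evalw_def eval[symmetric] T_def .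
  then have "hform r h (a ^ t) (b ^ s) = 0"
    using \<open>a \<noteq> 0\<close> \<open>b \<noteq> 0\<close> by simp
  then obtain c where c: "a ^ t = const2 c * b ^ s" "poly h c = 0"
    using hform_eq_0_imp_root[of r h "a ^ t" "b ^ s"] \<open>b \<noteq> 0\<close> \<open>h \<noteq> 0\<close> deg by auto
  have "(var_x ^ t - const2 c * var_y ^ s) dvd p"
    using dvd_hform_if_root[OF c(2) \<open>h \<noteq> 0\<close> deg] by (subst p) (rule dvd_mult)
  then show ?thesis
    using c(1) by blast
qed

subsection \<open>Rentschler's theorem\<close>

lemma ex_antiderivative: "\<exists>q. pderiv q = p" for p :: "'a::field_char_0 poly"
proof
  have "pderiv (\<Sum>k\<le>degree p. monom (coeff p k / of_nat (Suc k)) (Suc k))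
      = (\<Sum>k\<le>degree p. monom (coeff p k) k)"
    unfolding pderiv_sum_fun by (intro sum.cong) (simp_all add: pderiv_monom del: of_nat_Suc)
  also have "\<dots> = p"
    by (rule poly_as_sum_of_monoms)
  finally show "pderiv (\<Sum>k\<le>degree p. monom (coeff p k / of_nat (Suc k)) (Suc k)) = p" .
qed

text \<open>For an antiderivative \<open>q\<close> of \<open>f / c\<close>, the value
  \<open>D [:q:]\<close> is \<open>c\<close> times the derivative of \<open>q\<close>, which is
  \<open>D var_y\<close>.\<close>

lemma (in lnd) ex_shear_in_kernel:
  assumes "D var_x = const2 c" "c \<noteq> 0" "D var_y = [:f:]"
  shows "\<exists>q. D (var_y - [:q:]) = 0"
proof -
  obtain q where "pderiv q = smult (1 / c) f"
    using ex_antiderivative by blast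
  then have "D (var_y - [:q:]) = 0"
    using assms by (simp add: W2_diff W2_apply_poly_x W2 const2_def)
  then show ?thesis ..
qed

lemma ex_wdeg_le: "\<exists>N. wdeg_le n m (int N) p"
proof -
  have "bdd_above ((\<lambda>(i, j). n * i + m * j) ` {(i, j). cf p i j \<noteq> 0})"
    by (intro bdd_above_finite finite_imageI finite_support)
  then show ?thesis
    unfolding bdd_above_def wdeg_le_def weight_le_int_iff by (auto simp: image_iff)
qed

lemma wdeg_le_mono: "wdeg_le n m N p \<Longrightarrow> N \<le> M \<Longrightarrow> wdeg_le n m M p"
  by (fastforce simp: wdeg_le_def)

lemma wdeg_le_pred_if_hcomp_eq_0:
  assumes "wdeg_le n m N p" "hcomp n m N p = 0"
  shows "wdeg_le n m (N - 1) p"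
  unfolding wdeg_le_def
proof (intro allI impI)
  fix i j assume "cf p i j \<noteq> 0"
  then have "weight n m i j \<le> N" "weight n m i j \<noteq> N"
    using assms cf_hcomp[of n m N p i j] by (auto simp: wdeg_le_def)
  then show "weight n m i j \<le> N - 1"
    by simp
qed

lemma dvd_const2_mult_iff: "c \<noteq> 0 \<Longrightarrow> p dvd const2 c * q \<longleftrightarrow> p dvd q"
  using dvd_mult[of p "const2 c * q" "const2 (1 / c)"]
  by (auto simp flip: mult.assoc const2_mult)

lemma var_y_dvd_cancel: "var_y dvd var_x ^ k * q \<Longrightarrow> var_y dvd q"
proof -
  have dvd: "var_y dvd p \<longleftrightarrow> poly p 0 = 0" for p :: "'a poly poly"
    by (simp add: var_y_def poly_eq_0_iff_dvd)
  show "var_y dvd var_x ^ k * q \<Longrightarrow> var_y dvd q"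
    by (simp add: dvd var_x_def)
qed

lemma aut_dvd: "algebra_automorphism \<phi> \<Longrightarrow> p dvd q \<Longrightarrow> \<phi> p dvd \<phi> q"
  by (auto elim!: dvdE simp: aut_mult)

lemma aut_power: "algebra_automorphism \<phi> \<Longrightarrow> \<phi> (p ^ k) = \<phi> p ^ k"
  by (induction k) (simp_all add: aut_1 aut_mult)

lemma var_x_dvd_cancel: "var_x dvd var_y ^ k * q \<Longrightarrow> var_x dvd q"
  using var_y_dvd_cancel[of k "swap_xy q"] aut_dvd[OF swap_xy_automorphism, of var_x "var_y ^ k * q"]
    aut_dvd[OF swap_xy_automorphism, of var_y "swap_xy q"]
  by (simp add: aut_mult aut_power swap_xy_automorphism)

text \<open>A monomial that contains y has weight at least \<open>m\<close>.\<close>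

lemma poly_in_x_if_wdeg_le_pred:
  assumes "wdeg_le n m (int m - 1) p" "m > 0"
  shows "p = [:coeff p 0:]"
proof -
  have "cf p i j = 0" if "j > 0" for i j
  proof (rule ccontr)
    assume "cf p i j \<noteq> 0"
    then have "weight n m i j < int m"
      using assms by (fastforce simp: wdeg_le_def)
    moreover have "int m \<le> int m * int j"
      using that by (simp flip: of_nat_mult)
    ultimately show False
      using mult_nonneg_nonneg[of "int n" "int i"] unfolding weight_def by linarith
  qed
  then have "coeff p j = 0" if "j > 0" for j
    using that by (simp add: cf_def poly_eq_iff)
  then show ?thesis
    by (simp add: poly_eq_iff coeff_pCons split: nat.splits)
qed

lemma degree_less_if_coeff_eq_0:
  assumes "degree p \<le> k" "coeff p k = 0" "k > 0"
  shows "degree p < k"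
  using assms by (metis degree_0 leading_coeff_0_iff le_neq_implies_less)

text \<open>The descent step of Rentschler's theorem: a shear keeps the flow degree of x, so
  lowering that of y lowers their sum.\<close>

lemma ex_shear_lowers_degree:
  fixes D :: "'a::{alg_closed_field, field_char_0} poly poly \<Rightarrow> 'a poly poly"
  assumes D: "lnd D" and n: "n = degree (flow D var_x)" "n > 0" and m: "m = degree (flow D var_y)"
    and "n \<le> m"
  shows "\<exists>f. degree (flow D (var_y - [:f:])) < m"
proof -
  interpret lnd D by fact
  have "m > 0"
    using n \<open>n \<le> m\<close> by simp
  have flow_diff: "flow D (p - q) = flow D p - flow D q" for p q
    using flow_add[of "p - q" q] by simp
  \<comment> \<open>\<open>P e\<close> says that \<open>D\<close> raises weights by at most
    \<open>e\<close>. It takes an integer because \<open>P (- 1)\<close> expresses that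
    \<open>D\<close> lowers weights.\<close>
  define P where "P e \<longleftrightarrow> wdeg_le n m (int n + e) (D var_x) \<and> wdeg_le n m (int m + e) (D var_y)" for e
  show ?thesis
  proof (cases "P (- 1)")
    case True
    \<comment> \<open>As n \<le> m, both components have weight below that of y and so lie in
      K[x].\<close>
    then have "wdeg_le n m (int n - 1) (D var_x)" "wdeg_le n m (int m - 1) (D var_x)"
      "wdeg_le n m (int m - 1) (D var_y)"
      using \<open>n \<le> m\<close> by (auto simp: P_def elim: wdeg_le_mono)
    define \<alpha> where "\<alpha> = coeff (D var_x) 0"
    have x: "D var_x = [:\<alpha>:]" and y: "D var_y = [:coeff (D var_y) 0:]"
      unfolding \<alpha>_def by (rule poly_in_x_if_wdeg_le_pred; fact)+
    then obtain c where "\<alpha> = [:c:]"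
      using constant_if_D_var_x_eq by (metis degree_eq_zeroE)
    moreover have "D var_x \<noteq> 0"
      using n degree_flow_eq_0_iff[of var_x] by simp
    ultimately have c: "D var_x = const2 c" "c \<noteq> 0"
      using x by (auto simp: const2_def)
    obtain q where "D (var_y - [:q:]) = 0"
      using ex_shear_in_kernel[OF c y] by blast
    then show ?thesis
      using degree_flow_eq_0_iff[of "var_y - [:q:]"] \<open>m > 0\<close> by (intro exI[of _ q]) simp
  next
    case False
    obtain N1 N2 where "wdeg_le n m (int N1) (D var_x)" "wdeg_le n m (int N2) (D var_y)"
      using ex_wdeg_le by blast
    then have "P (int (N1 + N2))"
      unfolding P_def by (auto elim!: wdeg_le_mono)
    then have Least: "P (int (LEAST d. P (int d)))"
      by (rule LeastI)
    define d where "d = (LEAST d. P (int d))"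
    have "P (int d)"
      using Least by (simp add: d_def)
    \<comment> \<open>For \<open>d = 0\<close> this is the case assumption, otherwise minimality of
      \<open>d\<close>; it ensures that the top part is nonzero.\<close>
    have "\<not> P (int d - 1)"
    proof (cases d)
      case 0
      then show ?thesis
        using False by simp
    next
      case (Suc e)
      then have "\<not> P (int e)"
        using not_less_Least[of e "\<lambda>d. P (int d)"] by (simp add: d_def)
      then show ?thesis
        by (simp add: Suc)
    qed
    have Dx: "wdeg_le n m (int n + int d) (D var_x)" and Dy: "wdeg_le n m (int m + int d) (D var_y)"
      using \<open>P (int d)\<close> by (simp_all add: P_def)
    define T where "T = top_der n m D d"
    interpret T: lnd T
      unfolding T_def by (rule lnd_top_der[OF W2 Dx Dy locally_nilpotent])
    have T_nonzero: "T var_x \<noteq> 0 \<or> T var_y \<noteq> 0"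
    proof (rule ccontr)
      assume "\<not> ?thesis"
      then have "hcomp n m (int n + int d) (D var_x) = 0" "hcomp n m (int m + int d) (D var_y) = 0"
        by (simp_all add: T_def top_der_def[OF W2 Dx Dy])
      then show False
        using \<open>\<not> P (int d - 1)\<close> wdeg_le_pred_if_hcomp_eq_0[OF Dx] wdeg_le_pred_if_hcomp_eq_0[OF Dy]
        by (simp add: P_def add_diff_eq)
    qed
    define a b where "a = lead_coeff (flow D var_x)" and "b = lead_coeff (flow D var_y)"
    have ab: "a \<noteq> 0" "b \<noteq> 0"
      by (simp_all add: a_def b_def)
    define g where "g = gcd n m"
    then obtain s t where st: "n = g * s" "m = g * t" "coprime s t" "g > 0"
      using n(2) gcd_coprime_exists[of n m] by (metis gcd_pos_nat mult.commute not_gr_zero)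
    have "s > 0" "t > 0"
      using st \<open>n > 0\<close> \<open>m > 0\<close> by (metis mult_0_right not_gr_zero)+
    \<comment> \<open>\<open>D\<close> lowers the degree of the flow while \<open>T\<close> does not lower the weight (as \<open>d \<ge> 0\<close>), so \<open>T p\<close>
      vanishes at the leading coefficients.\<close>
    have vanish: "\<exists>c. a ^ t = const2 c * b ^ s \<and> (var_x ^ t - const2 c * var_y ^ s) dvd T p"
      if p: "\<And>i j. cf p i j \<noteq> 0 \<Longrightarrow> n * i + m * j = N" and "T p \<noteq> 0" for p N
    proof -
      have le: "wdeg_le n m (int N) p"
        using p by (simp add: wdeg_le_def weight_le_int_iff)
      have "hcomp n m (int N) p = p"
        by (rule cf_eqI) (use p in \<open>auto simp: weight_eq_int_iff\<close>)
      then have Tp: "T p = hcomp n m (int (N + d)) (D p)"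
        using hcomp_D[OF W2 Dx Dy le] by (simp add: T_def)
      have "coeff (flow D (D p)) (N + d) = 0"
        using degree_flow_le[OF n m \<open>m > 0\<close> le]
        by (simp flip: pderiv_flow add: coeff_pderiv coeff_eq_0)
      moreover have "wdeg_le n m (int (N + d)) (D p)"
        using wdeg_le_D[OF W2 Dx Dy le] by simp
      ultimately have "evalw n m (N + d) a b (D p) = 0"
        using coeff_flow_conv_evalw[OF n m \<open>m > 0\<close>] by (simp add: a_def b_def)
      moreover have "evalw n m (N + d) a b (T p) = evalw n m (N + d) a b (D p)"
        unfolding evalw_def by (intro sum.cong) (auto simp: Tp weight_eq_int_iff simp del: of_nat_add)
      ultimately have 0: "evalw (g * s) (g * t) (N + d) a b (T p) = 0"
        by (simp add: st)
      have "g * s * i + g * t * j = N + d" if "cf (T p) i j \<noteq> 0" for i j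
        using that unfolding Tp cf_hcomp weight_eq_int_iff st by (metis (full_types))
      from vanishing_weighted_homogeneous[OF st(3) \<open>s > 0\<close> \<open>t > 0\<close> st(4) this \<open>T p \<noteq> 0\<close> 0 ab]
      show ?thesis .
    qed
    have "n * i + m * j = n" if "cf var_x i j \<noteq> (0::'a)" for i j
      using that by (simp add: cf_var_x split: if_splits)
    moreover have "n * i + m * j = m" if "cf var_y i j \<noteq> (0::'a)" for i j
      using that by (simp add: cf_var_y split: if_splits)
    \<comment> \<open>The constant comes from \<open>vanish\<close> at x or y, whichever
      \<open>T\<close> does not kill.\<close>
    ultimately obtain c where c: "a ^ t = const2 c * b ^ s"
      using T_nonzero vanish by meson
    have "c \<noteq> 0"
      using c ab by auto
    define u where "u = var_x ^ t - const2 c * var_y ^ s"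
    \<comment> \<open>Otherwise \<open>vanish\<close> at \<open>u\<close>, of weight n t = m s,
      gives a binomial factor of \<open>T u\<close>. Its constant is again \<open>c\<close>, as
      \<open>b\<close> is nonzero, so \<open>u\<close> divides \<open>T u\<close>, against
      \<open>eq_0_if_dvd\<close>.\<close>
    have "T u = 0"
    proof (rule ccontr)
      assume "T u \<noteq> 0"
      have "cf u i j = (if i = t \<and> j = 0 then 1 else 0) - c * (if i = 0 \<and> j = s then 1 else 0)" for i j
        using cf_monomial[where 'a = 'a, of t 0 i j] cf_monomial[where 'a = 'a, of 0 s i j]
        by (simp only: u_def cf_diff cf_const2_mult power_0 mult_1_left mult_1_right)
      then have "n * i + m * j = n * t" if "cf u i j \<noteq> 0" for i j
        using that st by (auto split: if_splits)
      from vanish[OF this \<open>T u \<noteq> 0\<close>] obtain c'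
        where c': "a ^ t = const2 c' * b ^ s" "(var_x ^ t - const2 c' * var_y ^ s) dvd T u"
        by blast
      then have "c' = c"
        using c ab by simp
      then show False
        using c' T.eq_0_if_dvd[of u] \<open>T u \<noteq> 0\<close> by (simp add: u_def)
    qed
    then have "of_nat t * var_x ^ (t - 1) * T var_x = const2 c * (of_nat s * var_y ^ (s - 1) * T var_y)"
      by (simp add: u_def W2_diff W2_const2_mult W2_power T.W2)
    then have eq: "const2 (of_nat t) * (var_x ^ (t - 1) * T var_x) =
        const2 (c * of_nat s) * (var_y ^ (s - 1) * T var_y)"
      by (simp add: const2_of_nat const2_mult mult.assoc)
    have T_var: "T var_x \<noteq> 0" "T var_y \<noteq> 0"
      using T_nonzero eq \<open>s > 0\<close> \<open>t > 0\<close> \<open>c \<noteq> 0\<close> by auto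
    have "s \<le> t"
      using \<open>n \<le> m\<close> st by simp
    \<comment> \<open>Otherwise y divides the right side of \<open>eq\<close> and x the left, since
      \<open>s \<le> t\<close>. Then y divides \<open>T var_x\<close> and x divides
      \<open>T var_y\<close>, which \<open>not_mutually_dvd\<close> excludes.\<close>
    have "s = 1"
    proof (rule ccontr)
      assume "s \<noteq> 1"
      then have "s - 1 > 0" "t - 1 > 0"
        using \<open>s > 0\<close> \<open>s \<le> t\<close> by auto
      then have "var_y dvd var_y ^ (s - 1) * T var_y" "var_x dvd var_x ^ (t - 1) * T var_x"
        by (simp_all add: dvd_mult2 dvd_power)
      then have "var_y dvd var_x ^ (t - 1) * T var_x" "var_x dvd var_y ^ (s - 1) * T var_y"
        using eq dvd_const2_mult_iff[of "of_nat t :: 'a"] dvd_const2_mult_iff[of "c * of_nat s"]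
          \<open>s > 0\<close> \<open>t > 0\<close> \<open>c \<noteq> 0\<close> by (metis mult_eq_0_iff not_gr_zero of_nat_eq_0_iff)+
      then show False
        using var_y_dvd_cancel var_x_dvd_cancel T.not_mutually_dvd T_var by blast
    qed
    \<comment> \<open>With s = 1 one has a^t = c b and m = n t, so x^t / c has the same flow degree
      and leading coefficient as y, and these cancel in the difference.\<close>
    define f where "f = monom (1 / c) t"
    have f: "[:f:] = const2 (1 / c) * var_x ^ t"
      using var_power_conv_monom[where 'a = 'a, of t 0] by (simp add: f_def const2_def monom_0 smult_monom)
    have "const2 (1 / c) * a ^ t = b"
      using c \<open>c \<noteq> 0\<close> \<open>s = 1\<close> by (simp flip: mult.assoc const2_mult)
    moreover have "degree (flow D (var_x ^ t)) = m"
      using n(1) st \<open>s = 1\<close> by (simp add: flow_power degree_power_eq)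
    moreover from this have "coeff (flow D (var_x ^ t)) m = a ^ t"
      using lead_coeff_power[of "flow D var_x" t] by (simp add: flow_power a_def)
    ultimately have "coeff (flow D (var_y - [:f:])) m = 0" "degree (flow D (var_y - [:f:])) \<le> m"
      by (auto simp: flow_diff f flow_const2_mult b_def m intro!: degree_diff_le)
    then show ?thesis
      using degree_less_if_coeff_eq_0 \<open>m > 0\<close> by blast
  qed
qed

text \<open>Induction on the sum of the flow degrees: exchange the variables so that x has the
  smaller one, then shear. The descent ends when the flow degree of x is zero, that is, when x is in
  the kernel.\<close>

theorem rentschler:
  fixes D :: "'a::{alg_closed_field, field_char_0} poly poly \<Rightarrow> 'a poly poly"
  assumes "lnd D"
  shows "\<exists>\<phi> f. algebra_automorphism \<phi> \<and> conj_der \<phi> D = der 0 [:f:]"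
  using assms
proof (induction "degree (flow D var_x) + degree (flow D var_y)" arbitrary: D rule: less_induct)
  case less
  \<comment> \<open>Any \<open>E\<close> with the same degree sum is allowed, so that this serves
    both \<open>D\<close> and its conjugate by the exchange of variables.\<close>
  have step: "\<exists>\<phi> f. algebra_automorphism \<phi> \<and> conj_der \<phi> E = der 0 [:f:]"
    if E: "lnd E" and le: "degree (flow E var_x) \<le> degree (flow E var_y)"
      and sum: "degree (flow E var_x) + degree (flow E var_y)
        = degree (flow D var_x) + degree (flow D var_y)"
    for E :: "'a poly poly \<Rightarrow> 'a poly poly"
  proof (cases "degree (flow E var_x) = 0")
    case True
    interpret lnd E by fact
    have "E var_x = 0"
      using True degree_flow_eq_0_iff by blast
    moreover obtain f where "E var_y = [:f:]"
      using D_var_y_if_D_var_x_eq_0 calculation by blast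
    ultimately have "E = der 0 [:f:]"
      by (intro W2_eqI) (simp_all add: W2 der_in_W2)
    then show ?thesis
      using aut_id by (metis conj_der_id)
  next
    case False
    then obtain f where f: "degree (flow E (var_y - [:f:])) < degree (flow E var_y)"
      using ex_shear_lowers_degree[OF E refl _ refl] le by blast
    \<comment> \<open>The conjugate has at y the flow degree of \<open>E\<close> at
      \<open>inv \<psi> var_y\<close>; hence the shear by \<open>f\<close> and not by
      \<open>- f\<close>.\<close>
    define \<psi> where "\<psi> = shear f"
    have \<psi>: "algebra_automorphism \<psi>"
      by (simp add: \<psi>_def shear_automorphism)
    have "inv \<psi> var_x = var_x" "inv \<psi> var_y = var_y - [:f:]"
      by (simp_all add: \<psi>_def inv_shear)
    then have "degree (flow (conj_der \<psi> E) var_x) + degree (flow (conj_der \<psi> E) var_y)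
        < degree (flow D var_x) + degree (flow D var_y)"
      using f by (simp add: degree_flow_conj_der[OF \<psi> E] flip: sum)
    from less.hyps[OF this lnd_conj_der[OF \<psi> E]] obtain \<phi> h
      where "algebra_automorphism \<phi>" "conj_der \<phi> (conj_der \<psi> E) = der 0 [:h:]"
      by blast
    then show ?thesis
      using \<psi> aut_comp conj_der_comp by metis
  qed
  show ?case
  proof (cases "degree (flow D var_x) \<le> degree (flow D var_y)")
    case True
    then show ?thesis
      using step less.prems by blast
  next
    case False
    note swap = swap_xy_automorphism
    have "degree (flow (conj_der swap_xy D) var_x) = degree (flow D var_y)"
      "degree (flow (conj_der swap_xy D) var_y) = degree (flow D var_x)"
      by (simp_all add: degree_flow_conj_der[OF swap less.prems] inv_swap_xy)
    then obtain \<phi> f where "algebra_automorphism \<phi>" "conj_der \<phi> (conj_der swap_xy D) = der 0 [:f:]"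
      using step[OF lnd_conj_der[OF swap less.prems]] False by auto
    then show ?thesis
      using swap aut_comp conj_der_comp by metis
  qed
qed

subsection \<open>Lie algebras of locally nilpotent derivations\<close>

definition lnd_algebra :: "('a::field_char_0 poly poly \<Rightarrow> 'a poly poly) set \<Rightarrow> bool" where
  "lnd_algebra L \<longleftrightarrow> lie_subalgebra L W2 \<and> (\<forall>D\<in>L. lnd D)"

lemma
  assumes "lnd_algebra L"
  shows lnd_algebra_lnd: "D \<in> L \<Longrightarrow> lnd D"
    and lnd_algebra_bracket: "D \<in> L \<Longrightarrow> E \<in> L \<Longrightarrow> lie_bracket D E \<in> L"
    and lnd_algebra_add: "D \<in> L \<Longrightarrow> E \<in> L \<Longrightarrow> (\<lambda>p. D p + E p) \<in> L"
    and lnd_algebra_scale: "D \<in> L \<Longrightarrow> (\<lambda>p. const2 c * D p) \<in> L"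
  using assms unfolding lnd_algebra_def lie_subalgebra_def scale2_conv_const2 by blast+

lemma lnd_algebra_conjugate:
  assumes "algebra_automorphism \<phi>" "lnd_algebra L"
  shows "lnd_algebra (conjugate \<phi> L)"
  using assms lie_subalgebra_conjugate[of \<phi> L] unfolding lnd_algebra_def
  by (auto simp: conjugate_eq intro: lnd_conj_der)

lemma ex_funpow_pderiv_const:
  fixes p :: "'b::{idom, ring_char_0} poly"
  assumes "p \<noteq> 0"
  shows "\<exists>r. r \<noteq> 0 \<and> (pderiv ^^ degree p) p = [:r:]"
  using assms
proof (induction "degree p" arbitrary: p)
  case 0
  then show ?case
    by (metis degree_eq_zeroE funpow_0 pCons_0_0)
next
  case (Suc k)
  then have "degree (pderiv p) = k" "pderiv p \<noteq> 0"
    by (simp add: degree_pderiv flip: Suc.hyps(2), simp add: pderiv_eq_0_iff flip: Suc.hyps(2))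
  then show ?case
    using Suc.hyps(1)[of "pderiv p"] by (simp add: funpow_Suc_right flip: Suc.hyps(2) del: funpow.simps)
qed

text \<open>Bracketing with \<open>f(x) \<partial>/\<partial>y\<close> lowers the degree in \<open>y\<close> of the \<open>x\<close>-component; when it lies in
  \<open>K[x]\<close>, local nilpotence makes it constant.\<close>

lemma ex_constant_x_component:
  assumes L: "lnd_algebra L" and f: "der 0 [:f:] \<in> L" "f \<noteq> 0" and E: "E \<in> L" "E var_x \<noteq> 0"
  shows "\<exists>F\<in>L. \<exists>\<alpha>. \<alpha> \<noteq> 0 \<and> F var_x = const2 \<alpha>"
    and "degree f > 0 \<Longrightarrow> \<exists>\<alpha>. E var_x = const2 \<alpha>"
proof -
  define F where "F k = (lie_bracket (der 0 [:f:]) ^^ k) E" for k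
  have F_in: "F k \<in> L" for k
    by (induction k) (simp_all add: F_def E f(1) lnd_algebra_bracket[OF L])
  have F_x: "F k var_x = smult (f ^ k) ((pderiv ^^ k) (E var_x))" for k
  proof (induction k)
    case (Suc k)
    have "F (Suc k) var_x = der 0 [:f:] (F k var_x) - F k 0"
      by (simp add: F_def lie_bracket_def)
    also have "F k 0 = 0"
      using lnd.W2[OF lnd_algebra_lnd[OF L F_in]] by (rule W2_0)
    finally show ?case
      by (simp add: Suc der_def partial_y_def pderiv_smult mult.commute)
  qed (simp add: F_def)
  define k where "k = degree (E var_x)"
  obtain r where r: "r \<noteq> 0" "(pderiv ^^ k) (E var_x) = [:r:]"
    using ex_funpow_pderiv_const[OF E(2)] by (auto simp: k_def)
  have F_x_k: "F k var_x = [:f ^ k * r:]"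
    by (simp add: F_x r)
  then have deg: "degree (f ^ k * r) = 0"
    by (rule lnd.constant_if_D_var_x_eq[OF lnd_algebra_lnd[OF L F_in]])
  then obtain \<alpha> where \<alpha>: "f ^ k * r = [:\<alpha>:]"
    by (rule degree_eq_zeroE)
  moreover have "\<alpha> \<noteq> 0"
    using \<alpha> f(2) r(1) by auto
  ultimately show "\<exists>F\<in>L. \<exists>\<alpha>. \<alpha> \<noteq> 0 \<and> F var_x = const2 \<alpha>"
    using F_in F_x_k by (metis const2_def)
  assume "degree f > 0"
  then have "k = 0"
    using deg f(2) r(1) by (simp add: degree_mult_eq degree_power_eq)
  then have "E var_x = F k var_x"
    by (simp add: F_def)
  then show "\<exists>\<alpha>. E var_x = const2 \<alpha>"
    by (auto simp: F_x_k \<alpha> const2_def)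
qed

text \<open>The bracket \<open>G\<close> of f \<partial>/\<partial>y with \<open>E\<close> kills x,
  so \<open>G var_y\<close> lies in K[x]. It equals f times the y-derivative of
  \<open>E var_y\<close>, up to a polynomial in x, so \<open>E var_y\<close> is at most linear in y;
  local nilpotence excludes the linear term.\<close>

lemma in_u2_if_constant_x_component:
  assumes L: "lnd_algebra L" and f: "der 0 [:f:] \<in> L" "f \<noteq> 0" and E: "E \<in> L" "E var_x = const2 \<alpha>"
  shows "E \<in> u2"
proof -
  interpret lnd E
    using L E(1) by (rule lnd_algebra_lnd)
  define G where "G = lie_bracket (der 0 [:f:]) E"
  interpret G: lnd G
    unfolding G_def by (intro lnd_algebra_lnd[OF L] lnd_algebra_bracket[OF L] f E)
  have "G var_x = 0"
    by (simp add: G_def lie_bracket_def E W2_0 W2 W2_const2 der_in_W2)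
  then obtain b where b: "G var_y = [:b:]"
    using G.D_var_y_if_D_var_x_eq_0 by blast
  have "E [:f:] = [:smult \<alpha> (pderiv f):]"
    by (simp add: W2_apply_poly_x W2 E const2_def)
  then have "smult f (pderiv (E var_y)) - [:smult \<alpha> (pderiv f):] = [:b:]"
    using b unfolding G_def lie_bracket_def der_var by (simp add: der_def partial_y_def)
  then have "smult f (pderiv (E var_y)) = [:b + smult \<alpha> (pderiv f):]"
    by (simp add: diff_eq_eq)
  then have "degree (pderiv (E var_y)) = 0"
    using f(2) by (metis degree_pCons_0 degree_smult_eq)
  then have "degree (E var_y) \<le> 1"
    by (simp add: degree_pderiv)
  then have "coeff (E var_y) k = 0" if "k > 1" for k
    using that by (simp add: coeff_eq_0)
  then have Ey: "E var_y = [:coeff (E var_y) 0, coeff (E var_y) 1:]"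
    by (auto simp: poly_eq_iff coeff_pCons split: nat.splits)
  have "coeff (E var_y) 1 = 0"
    using no_linear_term_if_D_var_eq[OF E(2) Ey] .
  then show ?thesis
    using Ey E W2 by (auto simp: u2_iff)
qed

lemma subset_u2_if_nonconstant:
  assumes "lnd_algebra L" "der 0 [:f:] \<in> L" "degree f > 0"
  shows "L \<subseteq> u2"
proof
  fix E assume "E \<in> L"
  have "f \<noteq> 0"
    using assms(3) by auto
  have "\<exists>\<alpha>. E var_x = const2 \<alpha>"
  proof (cases "E var_x = 0")
    case True
    then show ?thesis
      using const2_simps(1) by metis
  next
    case False
    then show ?thesis
      using ex_constant_x_component(2)[OF assms(1,2) \<open>f \<noteq> 0\<close> \<open>E \<in> L\<close>] assms(3) by blast
  qed
  then show "E \<in> u2"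
    using in_u2_if_constant_x_component[OF assms(1,2) \<open>f \<noteq> 0\<close> \<open>E \<in> L\<close>] by blast
qed

section \<open>Triangularization\<close>

definition triangularizable :: "('a::field poly poly \<Rightarrow> 'a poly poly) set \<Rightarrow> bool" where
  "triangularizable L \<longleftrightarrow> (\<exists>\<phi>. algebra_automorphism \<phi> \<and> conjugate \<phi> L \<subseteq> u2)"

lemma triangularizable_if_subset: "L \<subseteq> u2 \<Longrightarrow> triangularizable L"
  unfolding triangularizable_def using aut_id by (auto simp: conjugate_eq intro!: exI[of _ id])

lemma triangularizable_if_conjugate:
  "algebra_automorphism \<phi> \<Longrightarrow> triangularizable (conjugate \<phi> L) \<Longrightarrow> triangularizable L"
  unfolding triangularizable_def using conjugate_comp aut_comp by metis

lemma aut_const2: "algebra_automorphism \<phi> \<Longrightarrow> \<phi> (const2 c) = const2 c"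
  using aut_const2_mult[of \<phi> c 1] by (simp add: aut_1)

text \<open>Subtracting constant coefficients gives an element of \<open>L\<close> all of whose values vanish at the origin;
  such a derivation has no slice, so its normal form is \<open>f(x) \<partial>/\<partial>y\<close> with \<open>f\<close> nonconstant.\<close>

lemma triangularizable_if_partials:
  fixes L :: "('a::{alg_closed_field, field_char_0} poly poly \<Rightarrow> 'a poly poly) set"
  assumes L: "lnd_algebra L" and "der 1 0 \<in> L" "der 0 1 \<in> L"
  shows "triangularizable L"
proof (cases "\<forall>E\<in>L. \<exists>\<alpha> \<beta>. E var_x = const2 \<alpha> \<and> E var_y = const2 \<beta>")
  case True
  then have "L \<subseteq> u2"
    using lnd.W2[OF lnd_algebra_lnd[OF L]] by (fastforce simp: u2_iff const2_def)
  then show ?thesis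
    by (rule triangularizable_if_subset)
next
  case False
  then obtain E where E: "E \<in> L" "\<And>\<alpha> \<beta>. E var_x = const2 \<alpha> \<Longrightarrow> E var_y \<noteq> const2 \<beta>"
    by blast
  define \<alpha> \<beta> where "\<alpha> = cf (E var_x) 0 0" and "\<beta> = cf (E var_y) 0 0"
  define F where "F p = E p + (const2 (- \<alpha>) * der 1 0 p + const2 (- \<beta>) * der 0 1 p)" for p
  have "F \<in> L"
    unfolding F_def[abs_def]
    by (intro lnd_algebra_add[OF L] lnd_algebra_scale[OF L] E assms)
  interpret lnd F
    using L \<open>F \<in> L\<close> by (rule lnd_algebra_lnd)
  have F_x: "F var_x = E var_x + const2 (- \<alpha>)" and F_y: "F var_y = E var_y + const2 (- \<beta>)"
    by (simp_all add: F_def)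
  have cf_const2: "cf (const2 c) 0 0 = c" for c :: 'a
    by (simp add: cf_def const2_def)
  have F_origin: "cf (F p) 0 0 = 0" for p
    by (subst W2_apply[OF W2]) (simp add: cf_mult F_x F_y cf_const2 \<alpha>_def \<beta>_def)
  obtain \<phi> f where \<phi>: "algebra_automorphism \<phi>" "conj_der \<phi> F = der 0 [:f:]"
    using rentschler[OF lnd_axioms] by blast
  have "degree f > 0"
  proof (rule ccontr)
    assume "\<not> degree f > 0"
    then obtain c where "f = [:c:]"
      by (metis degree_eq_zeroE gr0I)
    then have "\<phi> (F (inv \<phi> var_y)) = const2 c"
      using fun_cong[OF \<phi>(2), of var_y] by (simp add: conj_der_def const2_def)
    then have F_c: "F (inv \<phi> var_y) = const2 c"
      by (metis \<phi>(1) aut_inv_apply(1) aut_const2)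
    then have "c = 0"
      using F_origin[of "inv \<phi> var_y"] by (simp add: cf_const2)
    \<comment> \<open>With \<open>c = 0\<close> the whole derivation \<open>F\<close> vanishes, so
      \<open>E\<close> would have constant components.\<close>
    then have "\<phi> (F (inv \<phi> p)) = 0" for p
      using fun_cong[OF \<phi>(2), of p] \<open>f = [:c:]\<close> by (simp add: conj_der_def der_def)
    then have "F p = 0" for p
      using \<phi>(1) by (metis aut_eq_0_iff aut_inv_apply(1))
    from this[of var_x] this[of var_y] have "E var_x = const2 \<alpha>" "E var_y = const2 \<beta>"
      using const2_diff[of 0 \<alpha>] const2_diff[of 0 \<beta>] by (simp_all add: F_x F_y)
    then show False
      using E(2) by blast
  qed
  moreover have "der 0 [:f:] \<in> conjugate \<phi> L"
    using \<open>F \<in> L\<close> \<phi>(2) by (auto simp: conjugate_eq intro: rev_image_eqI)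
  ultimately have "conjugate \<phi> L \<subseteq> u2"
    using subset_u2_if_nonconstant lnd_algebra_conjugate \<phi>(1) L by blast
  then show ?thesis
    using \<phi>(1) by (auto simp: triangularizable_def)
qed

text \<open>If some x-component is nonzero, brackets with \<partial>/\<partial>y produce an
  \<open>F\<close> whose x-component is a nonzero constant. A shear that moves a kernel element y -
  q(x) of \<open>F\<close> to y turns \<open>F\<close> into a multiple of \<partial>/\<partial>x and
  leaves \<partial>/\<partial>y fixed.\<close>

lemma triangularizable_if_partial_y:
  fixes L :: "('a::{alg_closed_field, field_char_0} poly poly \<Rightarrow> 'a poly poly) set"
  assumes L: "lnd_algebra L" and dy: "der 0 1 \<in> L"
  shows "triangularizable L"
proof -
  have one: "der 0 [:1:] \<in> L"
    using dy by (simp add: one_pCons)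
  note u2 = in_u2_if_constant_x_component[OF L one one_neq_zero]
  show ?thesis
  proof (cases "\<forall>E\<in>L. E var_x = 0")
    case True
    then have "L \<subseteq> u2"
      using u2[where \<alpha> = 0] by auto
    then show ?thesis
      by (rule triangularizable_if_subset)
  next
    case False
    then obtain F \<alpha> where F: "F \<in> L" "\<alpha> \<noteq> 0" "F var_x = const2 \<alpha>"
      using ex_constant_x_component(1)[OF L one one_neq_zero] by blast
    then obtain \<beta> where \<beta>: "F var_y = [:\<beta>:]"
      using u2 by (auto simp: u2_iff)
    interpret lnd F
      using L F(1) by (rule lnd_algebra_lnd)
    obtain q where F_y: "F (var_y - [:q:]) = 0"
      using ex_shear_in_kernel[OF F(3,2) \<beta>] by blast
    define \<psi> where "\<psi> = shear q"
    have \<psi>: "algebra_automorphism \<psi>"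
      by (simp add: \<psi>_def shear_automorphism)
    have inv: "inv \<psi> var_x = var_x" "inv \<psi> var_y = var_y - [:q:]"
      by (simp_all add: \<psi>_def inv_shear)
    note L' = lnd_algebra_conjugate[OF \<psi> L]
    have "der 0 1 [:q:] = 0"
      by (simp add: der_def partial_y_def pderiv_pCons)
    then have "conj_der \<psi> (der 0 1) = der 0 1"
      by (intro W2_eqI conj_der_in_W2 \<psi> der_in_W2)
        (simp_all add: conj_der_def inv aut_0 aut_1 \<psi> W2_diff der_in_W2)
    then have dy': "der 0 1 \<in> conjugate \<psi> L"
      using dy by (auto simp: conjugate_eq intro: rev_image_eqI)
    have "conj_der \<psi> F \<in> conjugate \<psi> L"
      using F(1) by (simp add: conjugate_eq)
    then have scaled: "(\<lambda>p. const2 (1 / \<alpha>) * conj_der \<psi> F p) \<in> conjugate \<psi> L"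
      by (rule lnd_algebra_scale[OF L'])
    have "(\<lambda>p. const2 (1 / \<alpha>) * conj_der \<psi> F p) = der 1 0"
    proof (rule W2_eqI)
      show "(\<lambda>p. const2 (1 / \<alpha>) * conj_der \<psi> F p) \<in> W2"
        using scaled L' by (blast intro: lnd.W2 lnd_algebra_lnd)
    qed (use F(2) in \<open>simp_all add: der_in_W2 conj_der_def inv F F_y aut_0 aut_const2 \<psi> flip: const2_mult\<close>)
    then have "der 1 0 \<in> conjugate \<psi> L"
      using scaled by simp
    then show ?thesis
      using triangularizable_if_partials[OF L' _ dy'] triangularizable_if_conjugate[OF \<psi>] by blast
  qed
qed

theorem lnd_algebra_triangularizable:
  fixes L :: "('a::{alg_closed_field, field_char_0} poly poly \<Rightarrow> 'a poly poly) set"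
  assumes L: "lnd_algebra L"
  shows "triangularizable L"
proof (cases "L \<subseteq> {\<lambda>p. 0}")
  case True
  then have "L \<subseteq> u2"
    using lie_subalgebra_u2 by (auto simp: lie_subalgebra_def)
  then show ?thesis
    by (rule triangularizable_if_subset)
next
  case False
  then obtain D where D: "D \<in> L" "D \<noteq> (\<lambda>p. 0)"
    by blast
  obtain \<phi> f where \<phi>: "algebra_automorphism \<phi>" "conj_der \<phi> D = der 0 [:f:]"
    using rentschler[OF lnd_algebra_lnd[OF L D(1)]] by blast
  note L' = lnd_algebra_conjugate[OF \<phi>(1) L]
  have f_in: "der 0 [:f:] \<in> conjugate \<phi> L"
    using D(1) \<phi>(2) by (auto simp: conjugate_eq intro: rev_image_eqI)
  \<comment> \<open>A nonconstant \<open>f\<close> forces the whole conjugate into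
    \<open>u2\<close>; a nonzero constant can be scaled to \<partial>/\<partial>y.\<close>
  have "triangularizable (conjugate \<phi> L)"
  proof (cases "degree f > 0")
    case True
    then show ?thesis
      using subset_u2_if_nonconstant[OF L' f_in] triangularizable_if_subset by blast
  next
    case False
    then obtain c where c: "f = [:c:]"
      by (metis degree_eq_zeroE gr0I)
    have "c \<noteq> 0"
    proof
      assume "c = 0"
      then have "\<phi> (D (inv \<phi> p)) = 0" for p
        using fun_cong[OF \<phi>(2), of p] c by (simp add: conj_der_def der_def)
      then have "D p = 0" for p
        using \<phi>(1) by (metis aut_eq_0_iff aut_inv_apply(1))
      then show False
        using D(2) by auto
    qed
    then have "const2 (1 / c) * [:f:] = 1"
      by (simp add: c const2_def one_pCons)
    then have "(\<lambda>p. const2 (1 / c) * der 0 [:f:] p) = der 0 1"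
      by (simp only: fun_eq_iff der_def mult_zero_left add_0 mult_1_left simp_thms flip: mult.assoc)
    then have "der 0 1 \<in> conjugate \<phi> L"
      using lnd_algebra_scale[OF L' f_in, of "1 / c"] by simp
    then show ?thesis
      by (rule triangularizable_if_partial_y[OF L'])
  qed
  then show ?thesis
    by (rule triangularizable_if_conjugate[OF \<phi>(1)])
qed

theorem theorem2:
  fixes L :: "('a::{alg_closed_field, field_char_0} poly poly \<Rightarrow> 'a poly poly) set"
  assumes "lie_subalgebra L W2"
    and "\<And>D. D \<in> L \<Longrightarrow> locally_nilpotent D"
  shows "\<exists>\<phi>. algebra_automorphism \<phi> \<and> lie_subalgebra (conjugate \<phi> L) u2"
proof -
  have "lnd_algebra L"
    using assms by (auto simp: lnd_algebra_def lnd_def lie_subalgebra_def)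
  then obtain \<phi> where \<phi>: "algebra_automorphism \<phi>" "conjugate \<phi> L \<subseteq> u2"
    using lnd_algebra_triangularizable unfolding triangularizable_def by blast
  \<comment> \<open>The ambient algebra enters \<open>lie_subalgebra\<close> only through the
    inclusion, so closure carries over from \<open>W2\<close> to \<open>u2\<close>.\<close>
  then have "lie_subalgebra (conjugate \<phi> L) u2"
    using lie_subalgebra_conjugate[OF \<phi>(1) assms(1)] by (simp add: lie_subalgebra_def)
  then show ?thesis
    using \<phi>(1) by blast
qed

end
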